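(* Let $\Bbbk$ be a field, $S=\Bbbk[x_1,\dots,x_n]$, and let $I \subsetneq S$ be a squarefree monomial ideal such that the minimal free resolution $\mathbb{F}$ of $S/I$ admits a DGA structure. Then the syzygies of $I$ are subadditive, i.e. $t_b \leq t_a + t_{b-a}$ for all $a,b$ with $1 \leq a < b \leq \operatorname{pdim} S/I$.
   Context: $S$ carries the fine $\mathbb{Z}^n$-grading. For $0 \le i \le \operatorname{pdim} S/I$ set $t_i := \max\{j : \beta^S_{i,j}(S/I) \neq 0\}$, where $\beta^S_{i,j}(S/I) = \dim_\Bbbk \operatorname{Tor}_i^S(S/I,\Bbbk)_j$ is the graded Betti number with respect to the standard $\mathbb{Z}$-grading (total degree). Let $\mathbb{F}$ be the minimal $\mathbb{Z}^n$-graded free resolution of $S/I$ with $\mathbb{F}_0=S$ and differential $\partial$, identified with $\bigoplus_i \mathbb{F}_i$; $|f|$ denotes the homological degree. A DGA structure on $\mathbb{F}$ is an $S$-linear map $* : \mathbb{F} \otimes_S \mathbb{F} \to \mathbb{F}$ respecting the $\mathbb{Z}^n$-grading, such that for all (homogeneous) $a,b,c\in\mathbb{F}$: (1) $*$ extends the usual multiplication on $\mathbb{F}_0 = S$ and $1 \in \mathbb{F}_0$ acts as the identity; (2) $\partial(a*b) = \partial(a)*b + (-1)^{|a|} a*\partial(b)$; (3) $|a*b| = |a|+|b|$; (4) $a*b = (-1)^{|a||b|} b*a$; (5) $(a*b)*c = a*(b*c)$. *)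

theory Defs
  imports Main "HOL-Library.Poly_Mapping" "HOL-Library.Extended_Nat"
begin

text \<open>The polynomial ring \<open>S = k[x\<^sub>1,\<dots>,x\<^sub>n]\<close>: the variables are the elements of a finite type
  \<open>'n\<close>, a monomial is an exponent vector \<open>'n \<Rightarrow>\<^sub>0 nat\<close>.\<close>

type_synonym ('n, 'k) mpoly = "('n \<Rightarrow>\<^sub>0 nat) \<Rightarrow>\<^sub>0 'k"

text \<open>Coordinatewise scalar multiplication on the free module with basis \<open>'b\<close>; used both over \<open>S\<close>
  and over the field \<open>k\<close>.\<close>

definition pscale :: "'a::comm_ring_1 \<Rightarrow> ('b \<Rightarrow>\<^sub>0 'a) \<Rightarrow> ('b \<Rightarrow>\<^sub>0 'a)" where
  "pscale s v = Poly_Mapping.map ((*) s) v"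

lemma lookup_pscale: "Poly_Mapping.lookup (pscale s v) b = s * Poly_Mapping.lookup v b"
  unfolding pscale_def by transfer (simp add: when_def)

lemma module_pscale: "module (pscale :: 'a::comm_ring_1 \<Rightarrow> ('b \<Rightarrow>\<^sub>0 'a) \<Rightarrow> ('b \<Rightarrow>\<^sub>0 'a))"
  by unfold_locales (auto intro!: poly_mapping_eqI simp: lookup_pscale Poly_Mapping.lookup_add algebra_simps)

lemma vector_space_pscale: "vector_space (pscale :: 'k::field \<Rightarrow> ('b \<Rightarrow>\<^sub>0 'k) \<Rightarrow> ('b \<Rightarrow>\<^sub>0 'k))"
  by unfold_locales (auto intro!: poly_mapping_eqI simp: lookup_pscale Poly_Mapping.lookup_add algebra_simps)

lemma module_times: "module ((*) :: 'a::comm_ring_1 \<Rightarrow> 'a \<Rightarrow> 'a)"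
  by unfold_locales (auto simp: algebra_simps)

text \<open>The ideal generated by \<open>A\<close> is the span of \<open>A\<close> in the ring seen as a module over itself.\<close>

abbreviation ideal_gen :: "'a::comm_ring_1 set \<Rightarrow> 'a set" where
  "ideal_gen A \<equiv> module.span (*) A"

definition squarefree_monomial_ideal :: "('n::finite, 'k::field) mpoly set \<Rightarrow> bool" where
  "squarefree_monomial_ideal I \<longleftrightarrow>
    (\<exists>M. (\<forall>m\<in>M. \<forall>x. Poly_Mapping.lookup m x \<le> 1) \<and> I = ideal_gen ((\<lambda>m. Poly_Mapping.single m 1) ` M))"

definition irrelevant_ideal :: "('n::finite, 'k::field) mpoly set" where
  "irrelevant_ideal = ideal_gen ((\<lambda>x. Poly_Mapping.single (Poly_Mapping.single x 1) 1) ` UNIV)"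


text \<open>A complex of \<open>\<int>\<^sup>n\<close>-graded free \<open>S\<close>-modules \<open>\<bigoplus>\<^sub>i F\<^sub>i\<close> with a homogeneous basis. The elements are
  the maps \<open>nat \<Rightarrow>\<^sub>0 S\<close> supported in the set \<open>gens\<close> of basis labels; the basis element \<open>b\<close> has
  homological degree \<open>hdeg b\<close> and multidegree \<open>mdeg b\<close>. Since every \<open>F\<^sub>i\<close> will be required to have
  finite rank, labels in \<open>nat\<close> suffice. The field \<open>aug\<close> is a lift \<open>F\<^sub>0 \<Rightarrow> S\<close> of the augmentation
  \<open>F\<^sub>0 \<Rightarrow> S/I\<close>, which exists because \<open>F\<^sub>0\<close> is free. Only the values of \<open>bdry\<close> and \<open>aug\<close> on the
  module itself are constrained.\<close>

record (overloaded) ('n, 'k) gcomplex =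
  gens :: "nat set"
  hdeg :: "nat \<Rightarrow> nat"
  mdeg :: "nat \<Rightarrow> 'n \<Rightarrow> int"
  bdry :: "(nat \<Rightarrow>\<^sub>0 ('n, 'k) mpoly) \<Rightarrow> (nat \<Rightarrow>\<^sub>0 ('n, 'k) mpoly)"
  aug :: "(nat \<Rightarrow>\<^sub>0 ('n, 'k) mpoly) \<Rightarrow> ('n, 'k) mpoly"

definition elems :: "('n::finite, 'k::field) gcomplex \<Rightarrow> (nat \<Rightarrow>\<^sub>0 ('n, 'k) mpoly) set" where
  "elems F = {v. Poly_Mapping.keys v \<subseteq> gens F}"

definition component :: "('n::finite, 'k::field) gcomplex \<Rightarrow> nat \<Rightarrow> (nat \<Rightarrow>\<^sub>0 ('n, 'k) mpoly) set" where
  "component F i = {v \<in> elems F. \<forall>b\<in>Poly_Mapping.keys v. hdeg F b = i}"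

definition poly_homogeneous :: "('n \<Rightarrow> int) \<Rightarrow> ('n::finite, 'k::field) mpoly set" where
  "poly_homogeneous d = {f. \<forall>m\<in>Poly_Mapping.keys f. \<forall>x. int (Poly_Mapping.lookup m x) = d x}"

definition homogeneous ::
    "('n::finite, 'k::field) gcomplex \<Rightarrow> ('n \<Rightarrow> int) \<Rightarrow> (nat \<Rightarrow>\<^sub>0 ('n, 'k) mpoly) set" where
  "homogeneous F d =
    {v \<in> elems F. \<forall>b\<in>Poly_Mapping.keys v. Poly_Mapping.lookup v b \<in> poly_homogeneous (\<lambda>x. d x - mdeg F b x)}"

definition linear_on ::
    "'a set \<Rightarrow> ('s \<Rightarrow> 'a \<Rightarrow> 'a) \<Rightarrow> ('s \<Rightarrow> 'c \<Rightarrow> 'c) \<Rightarrow> ('a::plus \<Rightarrow> 'c::plus) \<Rightarrow> bool" where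
  "linear_on A sc sc' f \<longleftrightarrow>
    (\<forall>v\<in>A. \<forall>w\<in>A. f (v + w) = f v + f w) \<and> (\<forall>s. \<forall>v\<in>A. f (sc s v) = sc' s (f v))"

definition graded_free_complex :: "('n::finite, 'k::field) gcomplex \<Rightarrow> bool" where
  "graded_free_complex F \<longleftrightarrow>
    (\<forall>i. finite {b \<in> gens F. hdeg F b = i}) \<and>
    linear_on (elems F) pscale pscale (bdry F) \<and>
    (\<forall>v\<in>component F 0. bdry F v = 0) \<and>
    (\<forall>i. \<forall>v\<in>component F (Suc i). bdry F v \<in> component F i) \<and>
    (\<forall>d. \<forall>v\<in>homogeneous F d. bdry F v \<in> homogeneous F d) \<and>
    (\<forall>v\<in>elems F. bdry F (bdry F v) = 0)"

text \<open>The last four conditions say that \<open>aug\<close> induces a surjection \<open>F\<^sub>0 \<Rightarrow> S/I\<close> of graded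
  modules whose kernel is the image of \<open>F\<^sub>1\<close>.\<close>

definition free_resolution ::
    "('n::finite, 'k::field) gcomplex \<Rightarrow> ('n, 'k) mpoly set \<Rightarrow> bool" where
  "free_resolution F I \<longleftrightarrow>
    graded_free_complex F \<and>
    (\<forall>i. {v \<in> component F (Suc i). bdry F v = 0} = bdry F ` component F (Suc (Suc i))) \<and>
    linear_on (component F 0) pscale (*) (aug F) \<and>
    (\<forall>d. \<forall>v\<in>component F 0 \<inter> homogeneous F d. aug F v \<in> poly_homogeneous d) \<and>
    (\<forall>f. \<exists>v\<in>component F 0. f - aug F v \<in> I) \<and>
    {v \<in> component F 0. aug F v \<in> I} = bdry F ` component F 1"

text \<open>The projective dimension of \<open>S/I\<close>: the least length of a graded free resolution
  (over \<open>S\<close>, finitely generated graded projective modules are free).\<close>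

definition pdim :: "('n::finite, 'k::field) mpoly set \<Rightarrow> enat" where
  "pdim I = Inf {enat l | l. \<exists>P. free_resolution P I \<and> (\<forall>b\<in>gens P. hdeg P b \<le> l)}"


text \<open>The complex \<open>P \<otimes>\<^sub>S k\<close>, where \<open>k = S/(x\<^sub>1,\<dots>,x\<^sub>n)\<close> via \<open>f \<mapsto> f(0)\<close>, consists of the maps
  \<open>nat \<Rightarrow>\<^sub>0 k\<close> supported in \<open>gens P\<close>. The differential \<open>\<partial> \<otimes> k\<close> is computed by lifting to \<open>P\<close>
  along \<open>k \<subseteq> S\<close>, applying \<open>\<partial>\<close>, and reducing the coefficients; \<open>j\<close> is the total degree.\<close>

definition tensor_k ::
    "('n::finite, 'k::field) gcomplex \<Rightarrow> nat \<Rightarrow> int \<Rightarrow> (nat \<Rightarrow>\<^sub>0 'k) set" where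
  "tensor_k P i j =
    {w. Poly_Mapping.keys w \<subseteq> {b \<in> gens P. hdeg P b = i \<and> (\<Sum>x\<in>UNIV. mdeg P b x) = j}}"

definition diff_k :: "('n::finite, 'k::field) gcomplex \<Rightarrow> (nat \<Rightarrow>\<^sub>0 'k) \<Rightarrow> (nat \<Rightarrow>\<^sub>0 'k)" where
  "diff_k P w =
    Poly_Mapping.map (\<lambda>f. Poly_Mapping.lookup f 0) (bdry P (Poly_Mapping.map (\<lambda>c. Poly_Mapping.single 0 c) w))"

text \<open>The dimension of \<open>H\<^sub>i(P \<otimes>\<^sub>S k)\<^sub>j\<close>, cycles modulo boundaries; the spaces are finite-dimensional
  and the boundaries are contained in the cycles.\<close>

definition homology_dim :: "('n::finite, 'k::field) gcomplex \<Rightarrow> nat \<Rightarrow> int \<Rightarrow> nat" where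
  "homology_dim P i j =
    vector_space.dim pscale {w \<in> tensor_k P i j. diff_k P w = 0} -
    vector_space.dim pscale (diff_k P ` tensor_k P (Suc i) j)"

text \<open>\<open>dim Tor\<^sub>i(S/I, k)\<^sub>j\<close>, with \<open>Tor\<close> computed from some chosen graded free resolution of \<open>S/I\<close>.\<close>

definition betti :: "('n::finite, 'k::field) mpoly set \<Rightarrow> nat \<Rightarrow> int \<Rightarrow> nat" where
  "betti I i j = homology_dim (SOME P. free_resolution P I) i j"

definition tdeg :: "('n::finite, 'k::field) mpoly set \<Rightarrow> nat \<Rightarrow> int" where
  "tdeg I i = Max {j. betti I i j \<noteq> 0}"


text \<open>A minimal free resolution with \<open>F\<^sub>0 = S\<close>; \<open>u\<close> is the label of the basis element \<open>1 \<in> F\<^sub>0\<close>.\<close>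

definition minimal_free_resolution ::
    "('n::finite, 'k::field) gcomplex \<Rightarrow> nat \<Rightarrow> ('n, 'k) mpoly set \<Rightarrow> bool" where
  "minimal_free_resolution F u I \<longleftrightarrow>
    free_resolution F I \<and>
    (\<forall>v\<in>elems F. \<forall>b. Poly_Mapping.lookup (bdry F v) b \<in> irrelevant_ideal) \<and>
    {b \<in> gens F. hdeg F b = 0} = {u} \<and>
    mdeg F u = (\<lambda>x. 0) \<and>
    (\<forall>f. aug F (Poly_Mapping.single u f) = f)"

text \<open>An \<open>S\<close>-linear map on \<open>F \<otimes>\<^sub>S F\<close> is given as an \<open>S\<close>-bilinear map on \<open>F \<times> F\<close>.\<close>

definition dga_structure ::
    "('n::finite, 'k::field) gcomplex \<Rightarrow> nat \<Rightarrow>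
      ((nat \<Rightarrow>\<^sub>0 ('n, 'k) mpoly) \<Rightarrow> (nat \<Rightarrow>\<^sub>0 ('n, 'k) mpoly) \<Rightarrow> (nat \<Rightarrow>\<^sub>0 ('n, 'k) mpoly)) \<Rightarrow> bool" where
  "dga_structure F u mul \<longleftrightarrow>
    (\<forall>a\<in>elems F. \<forall>b\<in>elems F. mul a b \<in> elems F) \<and>
    (\<forall>a\<in>elems F. linear_on (elems F) pscale pscale (mul a)) \<and>
    (\<forall>b\<in>elems F. linear_on (elems F) pscale pscale (\<lambda>a. mul a b)) \<and>
    (\<forall>d e. \<forall>a\<in>homogeneous F d. \<forall>b\<in>homogeneous F e. mul a b \<in> homogeneous F (\<lambda>x. d x + e x)) \<and>
    (\<forall>f g. mul (Poly_Mapping.single u f) (Poly_Mapping.single u g) = Poly_Mapping.single u (f * g)) \<and>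
    (\<forall>a\<in>elems F. mul (Poly_Mapping.single u 1) a = a \<and> mul a (Poly_Mapping.single u 1) = a) \<and>
    (\<forall>p q. \<forall>a\<in>component F p. \<forall>b\<in>component F q.
      bdry F (mul a b) = mul (bdry F a) b + pscale ((-1) ^ p) (mul a (bdry F b))) \<and>
    (\<forall>p q. \<forall>a\<in>component F p. \<forall>b\<in>component F q. mul a b \<in> component F (p + q)) \<and>
    (\<forall>p q. \<forall>a\<in>component F p. \<forall>b\<in>component F q. mul a b = pscale ((-1) ^ (p * q)) (mul b a)) \<and>
    (\<forall>a\<in>elems F. \<forall>b\<in>elems F. \<forall>c\<in>elems F. mul (mul a b) c = mul a (mul b c))"

definition admits_dga_structure :: "('n::finite, 'k::field) gcomplex \<Rightarrow> nat \<Rightarrow> bool" where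
  "admits_dga_structure F u \<longleftrightarrow> (\<exists>mul. dga_structure F u mul)"

end

theory Submission
  imports Defs
begin

text \<open>A basis element \<open>g\<close> of \<open>F\<^sub>b\<close> that occurs in a product \<open>p * q\<close> of basis elements \<open>p \<in> F\<^sub>a\<close> and
\<open>q \<in> F\<^sub>b\<^sub>-\<^sub>a\<close> has there a nonzero homogeneous coefficient of multidegree
\<open>deg p + deg q - deg g\<close>, so \<open>deg g \<le> deg p + deg q\<close> in every variable. As the basis elements of the
minimal resolution \<open>F\<close> realise the nonzero Betti numbers (\<open>betti_neq_0_iff\<close>), subadditivity
follows once every \<open>g\<close> is seen to occur in such a product (\<open>gen_occurs_in_product\<close>).

This is proved dually: an \<open>S\<close>-linear functional \<open>\<phi>\<close> on \<open>F\<^sub>b\<close> that kills all products in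
\<open>F\<^sub>a * F\<^sub>b\<^sub>-\<^sub>a\<close> is zero (\<open>functional_vanishing_on_products\<close>). The ideal being squarefree, every
basis element has a squarefree multidegree \<open>W\<close>, and \<open>x\<^sup>W \<in> I\<close> in positive homological degree
(\<open>minimal_gen_degree\<close>). Thus \<open>x\<^sup>W = \<partial>e\<close> for some \<open>e \<in> F\<^sub>1\<close> of multidegree \<open>W\<close>. The product
\<open>e * \<partial>g\<close> has multidegree \<open>2W\<close>; as the basis elements are squarefree, it is divisible by \<open>x\<^sup>W\<close>,
and the Leibniz rule shows that the quotient \<open>y\<close> satisfies \<open>\<partial>y = \<partial>g\<close>. So \<open>g - y\<close> is a cycle of
multidegree \<open>W\<close>, and by minimality it is a combination of basis elements of smaller degree, on
which \<open>\<phi>\<close> vanishes by induction. It remains to see that \<open>x\<^sup>W \<phi>(y) = \<phi>(e * \<partial>g)\<close> vanishes: by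
associativity the functional \<open>z \<mapsto> \<phi>(e * z)\<close> on \<open>F\<^sub>b\<^sub>-\<^sub>1\<close> kills \<open>F\<^sub>a\<^sub>-\<^sub>1 * F\<^sub>b\<^sub>-\<^sub>a\<close>, so it is zero by
induction on \<open>b\<close>. A product in \<open>F\<close> reaches \<open>g\<close> only up to monomial factors; for functionals these
factors cancel.

Betti numbers are read off an arbitrary graded resolution \<open>P\<close>. A graded homotopy equivalence of \<open>P\<close>
with \<open>F\<close> survives the tensor product with \<open>k\<close>, where the differential of \<open>F\<close> becomes zero; hence the
homology of \<open>P \<otimes> k\<close> is nonzero exactly in the degrees of the basis elements of \<open>F\<close>.\<close>

section \<open>Polynomials and monomial ideals\<close>

lemmas pscale_add_left = module.scale_left_distrib[OF module_pscale]
  and pscale_diff_right = module.scale_right_diff_distrib[OF module_pscale]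
  and pscale_sum_right = module.scale_sum_right[OF module_pscale]
  and pscale_assoc = module.scale_scale[OF module_pscale]
  and pscale_one [simp] = module.scale_one[OF module_pscale]
  and pscale_zero_left [simp] = module.scale_zero_left[OF module_pscale]
  and pscale_zero_right [simp] = module.scale_zero_right[OF module_pscale]

abbreviation lookup where "lookup \<equiv> Poly_Mapping.lookup"
abbreviation single where "single \<equiv> Poly_Mapping.single"
abbreviation keys where "keys \<equiv> Poly_Mapping.keys"

lemma poly_mapping_sum_single: "(\<Sum>b\<in>keys v. single b (lookup v b)) = v"
  by (rule poly_mapping_eqI)
    (auto simp: lookup_sum lookup_single when_def in_keys_iff)

lemma lookup_single_times_add:
  fixes f :: "('n \<Rightarrow>\<^sub>0 nat) \<Rightarrow>\<^sub>0 'a::comm_semiring_1"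
  shows "lookup (single W c * f) (W + m) = c * lookup f m"
proof -
  have "lookup (single W c * f) (W + m) = (\<Sum>k\<in>keys f. lookup (single W c * single k (lookup f k)) (W + m))"
    using arg_cong[OF poly_mapping_sum_single[of f], of "\<lambda>h. lookup (single W c * h) (W + m)"]
    unfolding sum_distrib_left lookup_sum by (rule sym)
  also have "\<dots> = (\<Sum>k\<in>keys f. if k = m then c * lookup f k else 0)"
    by (rule sum.cong) (auto simp: mult_single lookup_single when_def)
  finally show ?thesis
    by (auto simp: in_keys_iff)
qed

lemma single_times_cancel:
  fixes f g :: "('n \<Rightarrow>\<^sub>0 nat) \<Rightarrow>\<^sub>0 'a::comm_semiring_1"
  assumes "single W 1 * f = single W 1 * g"
  shows "f = g"
proof (rule poly_mapping_eqI)
  fix m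
  show "lookup f m = lookup g m"
    using arg_cong[OF assms, of "\<lambda>h. lookup h (W + m)"] by (simp add: lookup_single_times_add)
qed

lemma pscale_monomial_cancel:
  fixes v w :: "'b \<Rightarrow>\<^sub>0 (('n \<Rightarrow>\<^sub>0 nat) \<Rightarrow>\<^sub>0 'a::comm_ring_1)"
  assumes "pscale (single W 1) v = pscale (single W 1) w"
  shows "v = w"
proof (rule poly_mapping_eqI)
  fix b
  show "lookup v b = lookup w b"
    using arg_cong[OF assms, of "\<lambda>h. lookup h b"]
    by (auto simp: lookup_pscale intro: single_times_cancel)
qed

lemma exponent_add_eq_0_iff: "(k::'n \<Rightarrow>\<^sub>0 nat) + l = 0 \<longleftrightarrow> k = 0 \<and> l = 0"
  by (auto simp: poly_mapping_eq_iff fun_eq_iff lookup_add)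

text \<open>The constant term is multiplicative because \<open>0\<close> is the sum of two exponents in one way only.\<close>

lemma lookup_times_0:
  fixes f g :: "('n \<Rightarrow>\<^sub>0 nat) \<Rightarrow>\<^sub>0 'a::comm_semiring_1"
  shows "lookup (f * g) 0 = lookup f 0 * lookup g 0"
proof -
  have *: "lookup (single k c * single l d) 0 = lookup (single k c) 0 * lookup (single l d) 0"
    for k l :: "'n \<Rightarrow>\<^sub>0 nat" and c d :: 'a
    by (auto simp: mult_single lookup_single when_def exponent_add_eq_0_iff)
  have "lookup (single k c * g) 0 = lookup (single k c) 0 * lookup g 0" for k c
  proof -
    have "lookup (single k c * g) 0 = lookup (\<Sum>l\<in>keys g. single k c * single l (lookup g l)) 0"
      unfolding sum_distrib_left[symmetric] poly_mapping_sum_single ..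
    also have "\<dots> = lookup (single k c) 0 * (\<Sum>l\<in>keys g. lookup (single l (lookup g l)) 0)"
      unfolding lookup_sum * sum_distrib_left ..
    also have "(\<Sum>l\<in>keys g. lookup (single l (lookup g l)) 0) = lookup g 0"
      unfolding lookup_sum[symmetric] poly_mapping_sum_single ..
    finally show ?thesis .
  qed
  note ** = this
  have "lookup (f * g) 0 = lookup (\<Sum>k\<in>keys f. single k (lookup f k) * g) 0"
    unfolding sum_distrib_right[symmetric] poly_mapping_sum_single ..
  also have "\<dots> = (\<Sum>k\<in>keys f. lookup (single k (lookup f k)) 0) * lookup g 0"
    unfolding lookup_sum ** sum_distrib_right ..
  also have "(\<Sum>k\<in>keys f. lookup (single k (lookup f k)) 0) = lookup f 0"
    unfolding lookup_sum[symmetric] poly_mapping_sum_single ..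
  finally show ?thesis .
qed

lemma irrelevant_ideal_lookup_0:
  fixes f :: "('n::finite, 'k::field) mpoly"
  shows "f \<in> irrelevant_ideal \<Longrightarrow> lookup f 0 = 0"
  unfolding irrelevant_ideal_def
proof (induction rule: module.span_induct_alt[OF module_times, consumes 1, case_names base step])
  case base
  show ?case by simp
next
  case (step c x y)
  have "single i (Suc 0) \<noteq> 0" for i :: 'n
    by (metis lookup_single_eq lookup_zero nat.distinct(1))
  with step show ?case
    by (auto simp: lookup_add lookup_times_0 lookup_single when_def)
qed

lemma poly_homogeneousD:
  "f \<in> poly_homogeneous d \<Longrightarrow> m \<in> keys f \<Longrightarrow> int (lookup m x) = d x"
  unfolding poly_homogeneous_def by blast

lemma poly_homogeneousI:
  "(\<And>m x. m \<in> keys f \<Longrightarrow> int (lookup m x) = d x) \<Longrightarrow> f \<in> poly_homogeneous d"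
  unfolding poly_homogeneous_def by blast

text \<open>In the fine grading the degree determines the exponent vector, so a homogeneous polynomial is a
  single term.\<close>

lemma poly_homogeneous_iff:
  "f \<in> poly_homogeneous d \<longleftrightarrow> f = 0 \<or> (\<exists>m c. f = single m c \<and> (\<forall>x. int (lookup m x) = d x))"
proof
  assume f: "f \<in> poly_homogeneous d"
  show "f = 0 \<or> (\<exists>m c. f = single m c \<and> (\<forall>x. int (lookup m x) = d x))"
  proof (cases "f = 0")
    case False
    then obtain m where m: "m \<in> keys f"
      by (metis all_not_in_conv keys_eq_empty)
    have "m' = m" if "m' \<in> keys f" for m'
    proof (rule poly_mapping_eqI)
      fix x
      have "int (lookup m' x) = int (lookup m x)"
        using poly_homogeneousD[OF f m, of x] poly_homogeneousD[OF f that, of x] by linarith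
      then show "lookup m' x = lookup m x" by simp
    qed
    then have "keys f = {m}" using m by blast
    have "f = single m (lookup f m)"
    proof (rule poly_mapping_eqI)
      fix k
      show "lookup f k = lookup (single m (lookup f m)) k"
      proof (cases "k = m")
        case False
        then have "k \<notin> keys f" using \<open>keys f = {m}\<close> by blast
        with False show ?thesis by (simp add: lookup_single_not_eq in_keys_iff)
      qed simp
    qed
    moreover have "\<forall>x. int (lookup m x) = d x"
      using poly_homogeneousD[OF f m] by blast
    ultimately show ?thesis by blast
  qed simp
next
  assume "f = 0 \<or> (\<exists>m c. f = single m c \<and> (\<forall>x. int (lookup m x) = d x))"
  then show "f \<in> poly_homogeneous d"
    by (elim disjE exE conjE; intro poly_homogeneousI) (auto split: if_splits)
qed

lemma poly_homogeneous_0 [simp]: "0 \<in> poly_homogeneous d"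
  by (simp add: poly_homogeneous_iff)

lemma poly_homogeneous_add:
  "f \<in> poly_homogeneous d \<Longrightarrow> g \<in> poly_homogeneous d \<Longrightarrow> f + g \<in> poly_homogeneous d"
  using keys_add[of f g] unfolding poly_homogeneous_def by blast

lemma poly_homogeneous_times:
  assumes "f \<in> poly_homogeneous d" "g \<in> poly_homogeneous e"
  shows "f * g \<in> poly_homogeneous (\<lambda>x. d x + e x)"
proof (rule poly_homogeneousI)
  fix m x assume "m \<in> keys (f * g)"
  then obtain k l where "m = k + l" "k \<in> keys f" "l \<in> keys g"
    using keys_mult[of f g] by blast
  then show "int (lookup m x) = d x + e x"
    using poly_homogeneousD[OF assms(1), of k x] poly_homogeneousD[OF assms(2), of l x]
    by (simp add: lookup_add)
qed

lemma poly_homogeneous_single: "single m c \<in> poly_homogeneous (\<lambda>x. int (lookup m x))"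
  by (rule poly_homogeneousI) (simp split: if_splits)

lemma poly_homogeneous_nonneg:
  assumes "f \<in> poly_homogeneous d" "f \<noteq> 0"
  shows "0 \<le> d x"
proof -
  obtain m where "m \<in> keys f"
    using assms(2) by (metis all_not_in_conv keys_eq_empty)
  from poly_homogeneousD[OF assms(1) this, of x, symmetric] show ?thesis by simp
qed

lemma poly_homogeneous_lookup_0:
  assumes "f \<in> poly_homogeneous d" "lookup f 0 \<noteq> 0"
  shows "d x = 0"
proof -
  have "0 \<in> keys f" using assms(2) by (simp add: in_keys_iff)
  from poly_homogeneousD[OF assms(1) this, of x, symmetric] show ?thesis by simp
qed


lemma monomial_ideal_iff:
  fixes f :: "('n \<Rightarrow>\<^sub>0 nat) \<Rightarrow>\<^sub>0 'k::comm_ring_1"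
  shows "f \<in> ideal_gen ((\<lambda>m. single m 1) ` M) \<longleftrightarrow> (\<forall>m\<in>keys f. \<exists>m0\<in>M. \<exists>k. m = m0 + k)"
proof
  assume "f \<in> ideal_gen ((\<lambda>m. single m 1) ` M)"
  then show "\<forall>m\<in>keys f. \<exists>m0\<in>M. \<exists>k. m = m0 + k"
  proof (induction rule: module.span_induct_alt[OF module_times, consumes 1, case_names base step])
    case base
    show ?case by simp
  next
    case (step c g h)
    from step(1) obtain m0 where m0: "m0 \<in> M" "g = single m0 1" by blast
    show ?case
    proof
      fix m assume "m \<in> keys (c * g + h)"
      then consider "m \<in> keys (c * g)" | "m \<in> keys h"
        using keys_add[of "c * g" h] by blast
      then show "\<exists>m0\<in>M. \<exists>k. m = m0 + k"
      proof cases
        case 1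
        then obtain k where "m = k + m0"
          using keys_mult[of c g] m0(2) by (auto split: if_splits)
        then show ?thesis using m0(1) add.commute[of k m0] by blast
      qed (use step in blast)
    qed
  qed
next
  assume *: "\<forall>m\<in>keys f. \<exists>m0\<in>M. \<exists>k. m = m0 + k"
  have "single m (lookup f m) \<in> ideal_gen ((\<lambda>m. single m 1) ` M)" if m: "m \<in> keys f" for m
  proof -
    obtain m0 k where "m0 \<in> M" "m = m0 + k" using * m by blast
    then have "single m (lookup f m) = single k (lookup f m) * single m0 1"
      by (simp add: mult_single add.commute)
    also have "\<dots> \<in> ideal_gen ((\<lambda>m. single m 1) ` M)"
      using \<open>m0 \<in> M\<close> by (intro module.span_scale[OF module_times] module.span_base[OF module_times]) blast
    finally show ?thesis .
  qed
  then have "(\<Sum>m\<in>keys f. single m (lookup f m)) \<in> ideal_gen ((\<lambda>m. single m 1) ` M)"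
    by (rule module.span_sum[OF module_times])
  then show "f \<in> ideal_gen ((\<lambda>m. single m 1) ` M)"
    unfolding poly_mapping_sum_single .
qed

definition poly_part :: "('n \<Rightarrow> int) \<Rightarrow> ('n::finite, 'k::field) mpoly \<Rightarrow> ('n, 'k) mpoly" where
  "poly_part d f = Poly_Mapping.mapp (\<lambda>m c. c when (\<forall>x. int (lookup m x) = d x)) f"

lemma lookup_poly_part: "lookup (poly_part d f) m = (lookup f m when (\<forall>x. int (lookup m x) = d x))"
  by (auto simp: poly_part_def lookup_mapp when_def in_keys_iff)

lemma poly_part_homogeneous: "poly_part d f \<in> poly_homogeneous d"
  by (rule poly_homogeneousI) (auto simp: in_keys_iff lookup_poly_part split: if_splits)

lemma poly_part_add: "poly_part d (f + g) = poly_part d f + poly_part d g"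
  by (rule poly_mapping_eqI) (simp add: lookup_poly_part lookup_add when_def)

lemma poly_part_diff: "poly_part d (f - g) = poly_part d f - poly_part d g"
  by (rule poly_mapping_eqI) (simp add: lookup_poly_part lookup_minus when_def)

lemma poly_part_0 [simp]: "poly_part d 0 = 0"
  by (rule poly_mapping_eqI) (simp add: lookup_poly_part when_def)

lemma poly_part_of_homogeneous:
  assumes "f \<in> poly_homogeneous e"
  shows "poly_part d f = (if d = e then f else 0)"
proof (rule poly_mapping_eqI)
  fix m
  show "lookup (poly_part d f) m = lookup (if d = e then f else 0) m"
  proof (cases "m \<in> keys f")
    case True
    then have "(\<lambda>x. int (lookup m x)) = e"
      using poly_homogeneousD[OF assms] by blast
    then show ?thesis by (auto simp: lookup_poly_part when_def)
  next
    case False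
    then show ?thesis by (simp add: lookup_poly_part in_keys_iff)
  qed
qed

lemma keys_poly_part: "keys (poly_part d f) \<subseteq> keys f"
  unfolding poly_part_def by (rule keys_mapp_subset)

lemma squarefree_monomial_ideal_poly_part:
  assumes "squarefree_monomial_ideal I" "f \<in> I"
  shows "poly_part d f \<in> I"
proof -
  obtain M where "I = ideal_gen ((\<lambda>m. single m 1) ` M)"
    using assms(1) unfolding squarefree_monomial_ideal_def by blast
  then show ?thesis
    using assms(2) keys_poly_part[of d f] by (simp only: monomial_ideal_iff) blast
qed

text \<open>A squarefree generator of \<open>I\<close> that divides \<open>x\<^sup>m\<close> uses the variable \<open>x\<close> at most once, so it divides
  \<open>x\<^sup>m / x\<close> as well.\<close>

lemma squarefree_monomial_ideal_divide_variable:
  assumes "squarefree_monomial_ideal I" "single m c \<in> I" "lookup m x \<ge> 2"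
  shows "single (m - single x 1) c \<in> I"
proof -
  obtain M where M: "\<forall>m\<in>M. \<forall>x. lookup m x \<le> 1" "I = ideal_gen ((\<lambda>m. single m 1) ` M)"
    using assms(1) unfolding squarefree_monomial_ideal_def by blast
  show ?thesis
  proof (cases "c = 0")
    case False
    then obtain m0 k where m0: "m0 \<in> M" "m = m0 + k"
      using assms(2) unfolding M(2) monomial_ideal_iff by auto
    have "m - single x 1 = m0 + (k - single x 1)"
    proof (rule poly_mapping_eqI)
      fix y
      show "lookup (m - single x 1) y = lookup (m0 + (k - single x 1)) y"
      proof (cases "y = x")
        case True
        have "lookup m0 x \<le> 1" using M(1) m0(1) by blast
        with True assms(3) show ?thesis
          by (simp add: m0(2) lookup_minus lookup_add)
      next
        case False
        then show ?thesis by (simp add: m0(2) lookup_minus lookup_add lookup_single_not_eq)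
      qed
    qed
    then have "\<exists>m0\<in>M. \<exists>k. m - single x 1 = m0 + k" using m0(1) by blast
    then show ?thesis by (simp add: M(2) monomial_ideal_iff)
  qed (simp add: M(2) module.span_zero[OF module_times])
qed

section \<open>Linear maps on free modules\<close>

lemma pscale_single: "pscale s (single b t) = single b (s * t)"
  by (rule poly_mapping_eqI) (simp add: lookup_pscale lookup_single when_def)

lemma sum_pscale_unit: "(\<Sum>b\<in>keys v. pscale (lookup v b) (single b 1)) = v"
  by (simp add: pscale_single poly_mapping_sum_single)

lemma keys_pscale: "keys (pscale s v) \<subseteq> keys v"
  using mult_zero_right by (fastforce simp: in_keys_iff lookup_pscale)

lemma linear_on_0:
  assumes "module sc" "linear_on {v. keys v \<subseteq> G} pscale sc f"
  shows "f 0 = 0"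
proof -
  have "f (pscale 0 0) = sc 0 (f 0)"
    using assms(2) keys_zero unfolding linear_on_def by (metis (mono_tags) empty_subsetI mem_Collect_eq)
  then show ?thesis by (simp add: module.scale_zero_left[OF assms(1)])
qed

lemma linear_on_sum:
  assumes "module sc" "linear_on {v. keys v \<subseteq> G} pscale sc f"
    and "finite B" "\<And>b. b \<in> B \<Longrightarrow> keys (g b) \<subseteq> G"
  shows "f (\<Sum>b\<in>B. g b) = (\<Sum>b\<in>B. f (g b))"
  using assms(3,4)
proof (induction B rule: finite_induct)
  case empty
  then show ?case using linear_on_0[OF assms(1,2)] by simp
next
  case (insert b B)
  have "keys (sum g B) \<subseteq> G"
    using insert.prems keys_sum[of g B] by fastforce
  then have "f (g b + sum g B) = f (g b) + f (sum g B)"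
    using assms(2) insert.prems unfolding linear_on_def by simp
  then show ?case using insert by simp
qed

lemma linear_on_expand:
  assumes "module sc" "linear_on {v. keys v \<subseteq> G} pscale sc f" "keys v \<subseteq> G"
  shows "f v = (\<Sum>b\<in>keys v. sc (lookup v b) (f (single b 1)))"
proof -
  have "f v = f (\<Sum>b\<in>keys v. pscale (lookup v b) (single b 1))"
    by (simp add: sum_pscale_unit)
  also have "\<dots> = (\<Sum>b\<in>keys v. f (pscale (lookup v b) (single b 1)))"
    using assms(3) keys_pscale by (intro linear_on_sum[OF assms(1,2)]) fastforce+
  also have "\<dots> = (\<Sum>b\<in>keys v. sc (lookup v b) (f (single b 1)))"
    using assms(2,3) unfolding linear_on_def by (intro sum.cong) auto
  finally show ?thesis .
qed

definition lin_ext :: "('b \<Rightarrow> 'c \<Rightarrow>\<^sub>0 'a::comm_ring_1) \<Rightarrow> ('b \<Rightarrow>\<^sub>0 'a) \<Rightarrow> ('c \<Rightarrow>\<^sub>0 'a)" where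
  "lin_ext f v = (\<Sum>b\<in>keys v. pscale (lookup v b) (f b))"

lemma lin_ext_superset:
  "finite B \<Longrightarrow> keys v \<subseteq> B \<Longrightarrow> lin_ext f v = (\<Sum>b\<in>B. pscale (lookup v b) (f b))"
  unfolding lin_ext_def by (rule sum.mono_neutral_left) (auto simp: in_keys_iff)

lemma lin_ext_add: "lin_ext f (v + w) = lin_ext f v + lin_ext f w"
proof -
  have "lin_ext f (v + w) = (\<Sum>b\<in>keys v \<union> keys w. pscale (lookup (v + w) b) (f b))"
    using keys_add[of v w] by (intro lin_ext_superset) auto
  also have "\<dots> = lin_ext f v + lin_ext f w"
    by (simp add: lin_ext_superset[of "keys v \<union> keys w"] lookup_add pscale_add_left sum.distrib)
  finally show ?thesis .
qed

lemma lin_ext_pscale: "lin_ext f (pscale s v) = pscale s (lin_ext f v)"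
proof -
  have "lin_ext f (pscale s v) = (\<Sum>b\<in>keys v. pscale (lookup (pscale s v) b) (f b))"
    by (intro lin_ext_superset finite_keys keys_pscale)
  then show ?thesis
    by (simp add: lookup_pscale lin_ext_def pscale_sum_right pscale_assoc)
qed

lemma lin_ext_single: "lin_ext f (single b s) = pscale s (f b)"
  by (simp add: lin_ext_superset[of "{b}"])

lemma linear_on_eq_lin_ext:
  assumes "linear_on {v. keys v \<subseteq> G} pscale pscale f" "keys v \<subseteq> G"
  shows "f v = lin_ext (\<lambda>b. f (single b 1)) v"
  using linear_on_expand[OF module_pscale assms] by (simp add: lin_ext_def)


section \<open>Homogeneous components\<close>

lemma elems_eq: "elems F = {v. keys v \<subseteq> gens F}"
  by (simp add: elems_def)

lemma component_eq: "component F i = {v. keys v \<subseteq> {b \<in> gens F. hdeg F b = i}}"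
  by (auto simp: component_def elems_def)

lemma component_subset_elems: "component F i \<subseteq> elems F"
  by (auto simp: component_def)

lemma keys_subset_0: "0 \<in> {v. keys v \<subseteq> G}"
  by simp

lemma keys_subset_add: "v \<in> {v. keys v \<subseteq> G} \<Longrightarrow> w \<in> {v. keys v \<subseteq> G} \<Longrightarrow> v + w \<in> {v. keys v \<subseteq> G}"
  using keys_add[of v w] by blast

lemma keys_subset_diff:
  "v \<in> {v. keys v \<subseteq> G} \<Longrightarrow> w \<in> {v. keys v \<subseteq> G} \<Longrightarrow> v - w \<in> {v. keys v \<subseteq> G}"
  using keys_diff[of v w] by blast

lemma keys_subset_pscale: "v \<in> {v. keys v \<subseteq> G} \<Longrightarrow> pscale s v \<in> {v. keys v \<subseteq> G}"
  using keys_pscale[of s v] by blast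

lemma keys_subset_sum:
  "(\<And>b. b \<in> B \<Longrightarrow> g b \<in> {v. keys v \<subseteq> G}) \<Longrightarrow> sum g B \<in> {v. keys v \<subseteq> G}"
  using keys_sum[of g B] by blast

lemma elems_closed:
  "0 \<in> elems F"
  "v \<in> elems F \<Longrightarrow> w \<in> elems F \<Longrightarrow> v + w \<in> elems F"
  "v \<in> elems F \<Longrightarrow> w \<in> elems F \<Longrightarrow> v - w \<in> elems F"
  "v \<in> elems F \<Longrightarrow> pscale s v \<in> elems F"
  "(\<And>b. b \<in> B \<Longrightarrow> g b \<in> elems F) \<Longrightarrow> sum g B \<in> elems F"
  unfolding elems_eq
  by (fact keys_subset_0 keys_subset_add keys_subset_diff keys_subset_pscale keys_subset_sum)+

lemma component_closed:
  "0 \<in> component F i"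
  "v \<in> component F i \<Longrightarrow> w \<in> component F i \<Longrightarrow> v + w \<in> component F i"
  "v \<in> component F i \<Longrightarrow> w \<in> component F i \<Longrightarrow> v - w \<in> component F i"
  "v \<in> component F i \<Longrightarrow> pscale s v \<in> component F i"
  "(\<And>b. b \<in> B \<Longrightarrow> g b \<in> component F i) \<Longrightarrow> sum g B \<in> component F i"
  unfolding component_eq
  by (fact keys_subset_0 keys_subset_add keys_subset_diff keys_subset_pscale keys_subset_sum)+

lemma single_in_component: "b \<in> gens F \<Longrightarrow> hdeg F b = i \<Longrightarrow> single b s \<in> component F i"
  by (simp add: component_eq)

lemma single_in_elems: "b \<in> gens F \<Longrightarrow> single b s \<in> elems F"
  by (simp add: elems_eq)

lemma homogeneous_iff:
  "v \<in> homogeneous F d \<longleftrightarrow>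
    v \<in> elems F \<and> (\<forall>b. lookup v b \<in> poly_homogeneous (\<lambda>x. d x - mdeg F b x))"
proof -
  have "lookup v b \<in> poly_homogeneous e" if "b \<notin> keys v" for b e
    using that by (simp add: in_keys_iff)
  then show ?thesis unfolding homogeneous_def by blast
qed

lemma homogeneous_subset_elems: "homogeneous F d \<subseteq> elems F"
  by (auto simp: homogeneous_def)

lemma poly_homogeneous_sum:
  "(\<And>b. b \<in> B \<Longrightarrow> g b \<in> poly_homogeneous d) \<Longrightarrow> sum g B \<in> poly_homogeneous d"
  by (induction B rule: infinite_finite_induct) (auto intro: poly_homogeneous_add)

lemma poly_homogeneous_diff:
  "f \<in> poly_homogeneous d \<Longrightarrow> g \<in> poly_homogeneous d \<Longrightarrow> f - g \<in> poly_homogeneous d"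
  using keys_diff[of f g] unfolding poly_homogeneous_def by blast

lemma homogeneous_diff:
  "v \<in> homogeneous F d \<Longrightarrow> w \<in> homogeneous F d \<Longrightarrow> v - w \<in> homogeneous F d"
  by (simp add: homogeneous_iff elems_closed lookup_minus poly_homogeneous_diff)

lemma homogeneous_sum:
  "(\<And>b. b \<in> B \<Longrightarrow> g b \<in> homogeneous F d) \<Longrightarrow> sum g B \<in> homogeneous F d"
  by (simp add: homogeneous_iff elems_closed lookup_sum poly_homogeneous_sum)

lemma homogeneous_pscale:
  assumes "f \<in> poly_homogeneous e" "v \<in> homogeneous F d"
  shows "pscale f v \<in> homogeneous F (\<lambda>x. e x + d x)"
  using assms poly_homogeneous_times[OF assms(1), of "lookup v b" "\<lambda>x. d x - mdeg F b x" for b]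
  by (simp add: homogeneous_iff elems_closed lookup_pscale algebra_simps)

lemma single_homogeneous:
  fixes F :: "('n::finite, 'k::field) gcomplex"
  assumes "b \<in> gens F"
  shows "single b 1 \<in> homogeneous F (mdeg F b)"
proof -
  have "lookup (single b (1 :: ('n, 'k) mpoly)) c \<in> poly_homogeneous (\<lambda>x. mdeg F b x - mdeg F c x)" for c
    by (cases "b = c") (auto simp: lookup_single_not_eq intro!: poly_homogeneousI split: if_splits)
  then show ?thesis using assms by (simp add: homogeneous_iff single_in_elems)
qed

definition hom_part :: "('n::finite, 'k::field) gcomplex \<Rightarrow> ('n \<Rightarrow> int) \<Rightarrow>
    (nat \<Rightarrow>\<^sub>0 ('n, 'k) mpoly) \<Rightarrow> (nat \<Rightarrow>\<^sub>0 ('n, 'k) mpoly)" where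
  "hom_part F d v = Poly_Mapping.mapp (\<lambda>b. poly_part (\<lambda>x. d x - mdeg F b x)) v"

lemma lookup_hom_part:
  "lookup (hom_part F d v) b = poly_part (\<lambda>x. d x - mdeg F b x) (lookup v b)"
  by (cases "b \<in> keys v") (simp_all add: hom_part_def lookup_mapp in_keys_iff)

lemma keys_hom_part: "keys (hom_part F d v) \<subseteq> keys v"
  unfolding hom_part_def by (rule keys_mapp_subset)

lemma hom_part_homogeneous: "v \<in> elems F \<Longrightarrow> hom_part F d v \<in> homogeneous F d"
  using keys_hom_part[of F d v]
  by (auto simp: homogeneous_iff elems_def lookup_hom_part poly_part_homogeneous)

lemma hom_part_component: "v \<in> component F i \<Longrightarrow> hom_part F d v \<in> component F i"
  using keys_hom_part[of F d v] by (auto simp: component_eq)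

lemma hom_part_add: "hom_part F d (v + w) = hom_part F d v + hom_part F d w"
  by (rule poly_mapping_eqI) (simp add: lookup_hom_part lookup_add poly_part_add)

lemma hom_part_0 [simp]: "hom_part F d 0 = 0"
  by (rule poly_mapping_eqI) (simp add: lookup_hom_part)

lemma hom_part_of_homogeneous:
  assumes "v \<in> homogeneous F e"
  shows "hom_part F d v = (if d = e then v else 0)"
proof (rule poly_mapping_eqI)
  fix b
  have "lookup v b \<in> poly_homogeneous (\<lambda>x. e x - mdeg F b x)"
    using assms by (simp add: homogeneous_iff)
  moreover have "(\<lambda>x. d x - mdeg F b x) = (\<lambda>x. e x - mdeg F b x) \<longleftrightarrow> d = e"
    by (simp add: fun_eq_iff)
  ultimately show "lookup (hom_part F d v) b = lookup (if d = e then v else 0) b"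
    by (simp add: lookup_hom_part poly_part_of_homogeneous)
qed

lemma monomial_term_induct [consumes 1, case_names zero add monomial]:
  fixes v :: "'b \<Rightarrow>\<^sub>0 ('n \<Rightarrow>\<^sub>0 nat) \<Rightarrow>\<^sub>0 'k::comm_ring_1"
  assumes "keys v \<subseteq> G"
    and zero: "P 0"
    and add: "\<And>v w. keys v \<subseteq> G \<Longrightarrow> keys w \<subseteq> G \<Longrightarrow> P v \<Longrightarrow> P w \<Longrightarrow> P (v + w)"
    and monomial: "\<And>b m c. b \<in> G \<Longrightarrow> P (pscale (single m c) (single b 1))"
  shows "P v"
proof -
  have sum: "keys (sum g B) \<subseteq> G \<and> P (sum g B)"
    if "finite B" "\<And>b. b \<in> B \<Longrightarrow> keys (g b) \<subseteq> G \<and> P (g b)" for B and g :: "'z \<Rightarrow> _"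
    using that
  proof (induction B rule: finite_induct)
    case empty
    show ?case using zero by simp
  next
    case (insert b B)
    then have "P (g b + sum g B)" by (intro add) simp_all
    moreover have "keys (g b + sum g B) \<subseteq> G"
      using insert keys_add[of "g b" "sum g B"] by fastforce
    ultimately show ?case using insert by simp
  qed
  have "keys (pscale f (single b 1)) \<subseteq> G \<and> P (pscale f (single b 1))" if b: "b \<in> G" for b f
  proof -
    have "pscale f (single b 1) = (\<Sum>m\<in>keys f. pscale (single m (lookup f m)) (single b 1))"
      unfolding module.scale_sum_left[OF module_pscale, symmetric] poly_mapping_sum_single ..
    moreover have "keys (pscale s (single b 1)) \<subseteq> G" for s :: "('n \<Rightarrow>\<^sub>0 nat) \<Rightarrow>\<^sub>0 'k"
      using b by (simp add: pscale_single)
    ultimately show ?thesis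
      using sum[of "keys f" "\<lambda>m. pscale (single m (lookup f m)) (single b 1)"] monomial[OF b] by simp
  qed
  then have "keys (\<Sum>b\<in>keys v. pscale (lookup v b) (single b 1)) \<subseteq> G \<and>
      P (\<Sum>b\<in>keys v. pscale (lookup v b) (single b 1))"
    using assms(1) by (intro sum) auto
  then show ?thesis by (simp add: sum_pscale_unit)
qed

text \<open>The map \<open>f\<close> stands for a degree-preserving linear map and \<open>part\<close> for the projection of its target onto
  degree \<open>d\<close>; the target stays abstract because it is a complex for the differential and \<open>S\<close> for the
  augmentation. Both sides are additive in \<open>v\<close>, and \<open>v\<close> is a sum of terms \<open>c x\<^sup>m b\<close>, which are
  homogeneous.\<close>

lemma linear_map_hom_part:
  fixes F :: "('n::finite, 'k::field) gcomplex"
  assumes "module sc" and lin: "linear_on {v. keys v \<subseteq> G} pscale sc f" and "G \<subseteq> gens F"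
    and part_add: "\<And>y z. part (y + z) = part y + part z"
    and part: "\<And>e v. keys v \<subseteq> G \<Longrightarrow> v \<in> homogeneous F e \<Longrightarrow> part (f v) = (if d = e then f v else 0)"
    and "keys v \<subseteq> G"
  shows "f (hom_part F d v) = part (f v)"
  using \<open>keys v \<subseteq> G\<close>
proof (induction v rule: monomial_term_induct)
  case zero
  have "f 0 = 0" using linear_on_0[OF assms(1) lin] .
  moreover have "part 0 = 0" using part_add[of 0 0] by simp
  ultimately show ?case by simp
next
  case (add v w)
  then have "keys (hom_part F d v) \<subseteq> G" "keys (hom_part F d w) \<subseteq> G"
    using keys_hom_part by blast+
  with add lin show ?case by (simp add: hom_part_add linear_on_def part_add)
next
  case (monomial b m c)
  have v: "pscale (single m c) (single b 1) \<in> homogeneous F (\<lambda>x. int (lookup m x) + mdeg F b x)"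
    using monomial \<open>G \<subseteq> gens F\<close>
    by (intro homogeneous_pscale poly_homogeneous_single single_homogeneous) blast
  have "f 0 = 0" using linear_on_0[OF assms(1) lin] .
  moreover have "keys (pscale (single m c) (single b 1)) \<subseteq> G"
    using monomial by (simp add: pscale_single)
  ultimately show ?case
    by (simp add: hom_part_of_homogeneous[OF v] part[OF _ v])
qed

text \<open>An arbitrary preimage may be replaced by its part of degree \<open>d\<close>, since \<open>f\<close> commutes with taking
  parts.\<close>

lemma homogeneous_preimage:
  assumes lin: "linear_on (elems F) pscale pscale f"
    and deg: "\<And>d v. v \<in> homogeneous F d \<Longrightarrow> f v \<in> homogeneous G d"
    and z: "z \<in> f ` component F i" "z \<in> homogeneous G d"
  obtains y where "y \<in> component F i" "y \<in> homogeneous F d" "f y = z"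
proof -
  obtain y where y: "y \<in> component F i" "z = f y" using z(1) by blast
  have "f (hom_part F d y) = hom_part G d (f y)"
  proof (rule linear_map_hom_part[where G = "gens F" and part = "hom_part G d"])
    show "module pscale" by (rule module_pscale)
    show "linear_on {v. keys v \<subseteq> gens F} pscale pscale f" using lin by (simp add: elems_eq)
    show "hom_part G d (f v) = (if d = e then f v else 0)" if "v \<in> homogeneous F e" for e v
      using hom_part_of_homogeneous[OF deg[OF that]] .
    show "keys y \<subseteq> gens F" using y by (auto simp: component_eq)
  qed (simp_all add: hom_part_add)
  also have "\<dots> = z"
    using z y by (simp add: hom_part_of_homogeneous)
  finally show ?thesis
    using y component_subset_elems[of F i]
    by (intro that[of "hom_part F d y"]) (auto intro: hom_part_component hom_part_homogeneous)
qed

lemma lin_ext_component: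
  assumes "\<And>b. b \<in> gens P \<Longrightarrow> hdeg P b = i \<Longrightarrow> f b \<in> component Q j" "v \<in> component P i"
  shows "lin_ext f v \<in> component Q j"
  using assms unfolding lin_ext_def component_eq[of P]
  by (intro component_closed) auto

lemma lin_ext_elems:
  assumes "\<And>b. b \<in> gens P \<Longrightarrow> f b \<in> elems Q" "v \<in> elems P"
  shows "lin_ext f v \<in> elems Q"
  using assms unfolding lin_ext_def elems_eq[of P]
  by (intro elems_closed) auto

lemma lin_ext_homogeneous:
  assumes "\<And>b. b \<in> gens P \<Longrightarrow> f b \<in> homogeneous Q (mdeg P b)" "v \<in> homogeneous P d"
  shows "lin_ext f v \<in> homogeneous Q d"
  unfolding lin_ext_def
proof (rule homogeneous_sum)
  fix b assume "b \<in> keys v"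
  then have "b \<in> gens P" "lookup v b \<in> poly_homogeneous (\<lambda>x. d x - mdeg P b x)"
    using assms(2) by (auto simp: homogeneous_iff elems_eq)
  from homogeneous_pscale[OF this(2) assms(1)[OF this(1)]]
  show "pscale (lookup v b) (f b) \<in> homogeneous Q d" by simp
qed


section \<open>Degrees of the basis of a minimal resolution\<close>

lemma poly_homogeneous_divide_monomial:
  assumes "f \<in> poly_homogeneous e" "\<And>x. int (lookup W x) \<le> e x"
  shows "\<exists>g\<in>poly_homogeneous (\<lambda>x. e x - int (lookup W x)). f = single W 1 * g"
proof (cases "f = 0")
  case True
  then show ?thesis by (intro bexI[of _ 0]) auto
next
  case False
  then obtain m c where f: "f = single m c" and m: "\<And>x. int (lookup m x) = e x"
    using assms(1) unfolding poly_homogeneous_iff by blast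
  have le: "lookup W x \<le> lookup m x" for x
    using assms(2)[of x] m[of x] by linarith
  have "W + (m - W) = m"
    by (rule poly_mapping_eqI) (simp add: lookup_add lookup_minus le)
  then have "f = single W 1 * single (m - W) c"
    by (simp add: mult_single f)
  moreover have "single (m - W) c \<in> poly_homogeneous (\<lambda>x. e x - int (lookup W x))"
    using le m[symmetric] by (intro poly_homogeneousI) (auto simp: lookup_minus split: if_splits)
  ultimately show ?thesis by blast
qed

lemma homogeneous_divide_monomial:
  fixes F :: "('n::finite, 'k::field) gcomplex"
  assumes z: "z \<in> homogeneous F d"
    and le: "\<And>b x. b \<in> keys z \<Longrightarrow> int (lookup W x) \<le> d x - mdeg F b x"
  obtains y where "z = pscale (single W 1) y" "keys y \<subseteq> keys z"
    "y \<in> homogeneous F (\<lambda>x. d x - int (lookup W x))"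
proof -
  have "\<exists>g\<in>poly_homogeneous (\<lambda>x. d x - mdeg F b x - int (lookup W x)). lookup z b = single W 1 * g"
    if "b \<in> keys z" for b
    using z le[OF that] by (intro poly_homogeneous_divide_monomial) (simp_all add: homogeneous_iff)
  then obtain g where g: "\<And>b. b \<in> keys z \<Longrightarrow>
      g b \<in> poly_homogeneous (\<lambda>x. d x - mdeg F b x - int (lookup W x)) \<and> lookup z b = single W 1 * g b"
    by metis
  define y where "y = Poly_Mapping.mapp (\<lambda>b _. g b) z"
  have y: "lookup y b = (if b \<in> keys z then g b else 0)" for b
    by (simp add: y_def lookup_mapp when_def)
  have keys: "keys y \<subseteq> keys z"
    unfolding y_def by (rule keys_mapp_subset)
  show ?thesis
  proof (rule that[OF _ keys])
    show "z = pscale (single W 1) y"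
      by (rule poly_mapping_eqI) (use g in \<open>simp add: lookup_pscale y in_keys_iff\<close>)
    have "(\<lambda>x. d x - int (lookup W x) - mdeg F b x) = (\<lambda>x. d x - mdeg F b x - int (lookup W x))" for b
      by (simp add: fun_eq_iff)
    then show "y \<in> homogeneous F (\<lambda>x. d x - int (lookup W x))"
      using z keys g by (auto simp: homogeneous_iff elems_eq y)
  qed
qed

definition exponent :: "('n::finite \<Rightarrow> int) \<Rightarrow> ('n \<Rightarrow>\<^sub>0 nat)" where
  "exponent d = Abs_poly_mapping (\<lambda>x. nat (d x))"

lemma lookup_exponent [simp]: "lookup (exponent d) x = nat (d x)"
  by (simp add: exponent_def)

lemma graded_free_complexD:
  assumes "graded_free_complex F"
  shows "finite {b \<in> gens F. hdeg F b = i}"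
    and "linear_on (elems F) pscale pscale (bdry F)"
    and "v \<in> component F 0 \<Longrightarrow> bdry F v = 0"
    and "v \<in> component F (Suc i) \<Longrightarrow> bdry F v \<in> component F i"
    and "v \<in> homogeneous F d \<Longrightarrow> bdry F v \<in> homogeneous F d"
    and "v \<in> elems F \<Longrightarrow> bdry F (bdry F v) = 0"
  using assms unfolding graded_free_complex_def by blast+

context
  fixes F :: "('n::finite, 'k::field) gcomplex" and I
  assumes resolution: "free_resolution F I"
begin

lemma resolution_graded: "graded_free_complex F"
  using resolution by (simp add: free_resolution_def)

lemmas bdry_linear = graded_free_complexD(2)[OF resolution_graded]
  and bdry_component_0 = graded_free_complexD(3)[OF resolution_graded]
  and bdry_component = graded_free_complexD(4)[OF resolution_graded]
  and bdry_homogeneous = graded_free_complexD(5)[OF resolution_graded]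
  and bdry_bdry = graded_free_complexD(6)[OF resolution_graded]

lemma bdry_0: "bdry F 0 = 0"
  using linear_on_0[OF module_pscale bdry_linear[unfolded elems_eq]] .

lemma bdry_pscale: "v \<in> elems F \<Longrightarrow> bdry F (pscale s v) = pscale s (bdry F v)"
  using bdry_linear by (simp add: linear_on_def)

lemma bdry_add: "v \<in> elems F \<Longrightarrow> w \<in> elems F \<Longrightarrow> bdry F (v + w) = bdry F v + bdry F w"
  using bdry_linear by (simp add: linear_on_def)

lemma bdry_diff:
  assumes "v \<in> elems F" "w \<in> elems F"
  shows "bdry F (v - w) = bdry F v - bdry F w"
  using bdry_add[of "v - w" w] assms by (simp add: elems_closed)

lemma bdry_elems: "v \<in> elems F \<Longrightarrow> bdry F v \<in> elems F"
proof -
  assume v: "v \<in> elems F"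
  have "bdry F (single b 1) \<in> elems F" if "b \<in> gens F" for b
    using bdry_homogeneous[OF single_homogeneous[OF that]] homogeneous_subset_elems by blast
  moreover have "bdry F v = lin_ext (\<lambda>b. bdry F (single b 1)) v"
    using linear_on_eq_lin_ext[of "gens F"] bdry_linear v by (simp add: elems_eq)
  ultimately show ?thesis using v by (simp add: lin_ext_elems[of F])
qed

lemma cycle_is_boundary:
  assumes "v \<in> component F (Suc i)" "bdry F v = 0"
  shows "v \<in> bdry F ` component F (Suc (Suc i))"
  using assms resolution unfolding free_resolution_def by blast

lemma aug_cycle_is_boundary:
  "v \<in> component F 0 \<Longrightarrow> aug F v \<in> I \<Longrightarrow> v \<in> bdry F ` component F (Suc 0)"
  using resolution unfolding free_resolution_def by auto

lemma aug_bdry: "v \<in> component F (Suc 0) \<Longrightarrow> aug F (bdry F v) \<in> I"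
  using resolution unfolding free_resolution_def by auto

lemma homogeneous_cycle_is_boundary:
  assumes "v \<in> component F (Suc i)" "v \<in> homogeneous F d" "bdry F v = 0"
  obtains y where "y \<in> component F (Suc (Suc i))" "y \<in> homogeneous F d" "bdry F y = v"
  using homogeneous_preimage[OF bdry_linear bdry_homogeneous cycle_is_boundary[OF assms(1,3)] assms(2)]
  by blast

lemma homogeneous_aug_cycle_is_boundary:
  assumes "v \<in> component F 0" "v \<in> homogeneous F d" "aug F v \<in> I"
  obtains y where "y \<in> component F (Suc 0)" "y \<in> homogeneous F d" "bdry F y = v"
  using homogeneous_preimage[OF bdry_linear bdry_homogeneous aug_cycle_is_boundary[OF assms(1,3)] assms(2)]
  by blast

end

context
  fixes F :: "('n::finite, 'k::field) gcomplex" and u I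
  assumes minimal: "minimal_free_resolution F u I"
begin

lemma minimal_resolution: "free_resolution F I"
  using minimal by (simp add: minimal_free_resolution_def)

lemma minimal_u: "u \<in> gens F" "hdeg F u = 0" "mdeg F u x = 0" "aug F (single u f) = f"
  using minimal unfolding minimal_free_resolution_def by auto

lemma minimal_component_0: "component F 0 = {v. keys v \<subseteq> {u}}"
  using minimal unfolding minimal_free_resolution_def component_eq by simp

lemma minimal_component_0_single:
  assumes "v \<in> component F 0"
  shows "v = single u (lookup v u)"
proof (rule poly_mapping_eqI)
  fix b
  show "lookup v b = lookup (single u (lookup v u)) b"
  proof (cases "b = u")
    case False
    then have "b \<notin> keys v" using assms by (auto simp: minimal_component_0)
    with False show ?thesis by (simp add: in_keys_iff lookup_single_not_eq)
  qed simp
qed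

lemma minimal_bdry_const_coeff: "v \<in> elems F \<Longrightarrow> lookup (lookup (bdry F v) b) 0 = 0"
  using minimal unfolding minimal_free_resolution_def by (auto intro: irrelevant_ideal_lookup_0)

text \<open>Exactness makes the cycle a boundary, and boundaries in a minimal complex have their coefficients in
  the irrelevant ideal.\<close>

lemma minimal_cycle_const_coeff:
  assumes "v \<in> component F (Suc i)" "bdry F v = 0"
  shows "lookup (lookup v b) 0 = 0"
  using cycle_is_boundary[OF minimal_resolution assms] component_subset_elems minimal_bdry_const_coeff
  by blast

lemma minimal_bdry_gen_nonzero:
  assumes "g \<in> gens F" "hdeg F g = Suc i"
  shows "bdry F (single g 1) \<noteq> 0"
  using minimal_cycle_const_coeff[of "single g 1" i g] assms by (auto simp: single_in_component)

text \<open>By induction on the homological degree, with \<open>W\<close> the multidegree of \<open>g\<close> and \<open>z = \<partial>g \<noteq> 0\<close>. A basis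
  element \<open>b\<close> that occurs in \<open>z\<close> has \<open>deg b \<le> W\<close>, so \<open>W \<ge> 0\<close>, and \<open>x\<^sup>W \<in> I\<close> is inherited from
  \<open>b\<close>, or holds because \<open>z\<close> is a multiple of \<open>x\<^sup>W u\<close> with augmentation in \<open>I\<close>. Suppose that a variable
  \<open>x\<close> had exponent at least two in \<open>W\<close>. Then \<open>x\<close> divides \<open>z\<close> and \<open>z / x\<close> is again a boundary
  \<open>\<partial>w\<close>: in homological degree one because \<open>I\<close> is squarefree, above that because the basis
  elements in \<open>z\<close> are squarefree by induction and \<open>S\<close> is torsion-free. So \<open>g - x w\<close> is a cycle
  whose coefficient at \<open>g\<close> has constant term one, which contradicts minimality.\<close>

lemma minimal_gen_degree:
  assumes sqf: "squarefree_monomial_ideal I" and "g \<in> gens F"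
  shows "(\<forall>x. 0 \<le> mdeg F g x \<and> mdeg F g x \<le> 1) \<and> (hdeg F g \<noteq> 0 \<longrightarrow> single (exponent (mdeg F g)) 1 \<in> I)"
  using assms(2)
proof (induction "hdeg F g" arbitrary: g)
  case 0
  then have "g = u"
    using minimal unfolding minimal_free_resolution_def by (metis (mono_tags, lifting) mem_Collect_eq singletonD)
  then show ?case by (simp add: minimal_u)
next
  case (Suc n)
  define z where "z = bdry F (single g 1)"
  have g: "single g 1 \<in> component F (Suc n)"
    using Suc by (simp add: single_in_component)
  have z: "z \<in> component F n" "z \<in> homogeneous F (mdeg F g)" "z \<noteq> 0"
    unfolding z_def using Suc
    by (auto intro!: bdry_component[OF minimal_resolution g] bdry_homogeneous[OF minimal_resolution]
      single_homogeneous dest: minimal_bdry_gen_nonzero[of g n])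
  have coeff: "lookup z b \<in> poly_homogeneous (\<lambda>x. mdeg F g x - mdeg F b x)" for b
    using z(2) by (simp add: homogeneous_iff)
  have le: "mdeg F b x \<le> mdeg F g x" if "b \<in> keys z" for b x
    using poly_homogeneous_nonneg[OF coeff[of b], of x] that by (simp add: in_keys_iff)
  obtain M where I: "I = ideal_gen M"
    using sqf unfolding squarefree_monomial_ideal_def by blast
  obtain b where b: "b \<in> keys z" using z(3) by (metis all_not_in_conv keys_eq_empty)
  then have b': "b \<in> gens F" "hdeg F b = n" using z(1) by (auto simp: component_eq)
  note IH = Suc(1)[OF b'(2)[symmetric] b'(1)]
  have nonneg: "0 \<le> mdeg F g x" for x
    using IH le[OF b, of x] by (metis order_trans)
  define m where "m = exponent (mdeg F g)"
  \<comment> \<open>In homological degree one, \<open>z\<close> is a scalar multiple of \<open>x\<^sup>m u\<close>.\<close>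
  have z0: "\<exists>c. c \<noteq> 0 \<and> z = single u (single m c) \<and> single m c \<in> I" if "n = 0"
  proof -
    have zu: "z = single u (lookup z u)"
      using z(1) that by (intro minimal_component_0_single) simp
    with z(3) have "lookup z u \<noteq> 0" by (metis single_zero)
    with coeff[of u] obtain k c where kc: "lookup z u = single k c"
      "\<And>x. int (lookup k x) = mdeg F g x"
      by (auto simp: poly_homogeneous_iff minimal_u)
    have "lookup k x = lookup m x" for x
      using kc(2)[of x] by (simp add: m_def)
    then have "k = m" by (rule poly_mapping_eqI)
    moreover have "aug F z \<in> I"
      using aug_bdry[OF minimal_resolution] g that unfolding z_def by simp
    ultimately show ?thesis
      using zu kc(1) \<open>lookup z u \<noteq> 0\<close> by (metis minimal_u(4) single_zero)
  qed
  have in_I: "single m 1 \<in> I"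
  proof (cases n)
    case 0
    then obtain c where c: "c \<noteq> 0" "single m c \<in> I" using z0 by blast
    have "single 0 (inverse c) * single m c \<in> I"
      using c(2) unfolding I by (rule module.span_scale[OF module_times])
    then show ?thesis using c(1) by (simp add: mult_single)
  next
    case (Suc n')
    then have "single (exponent (mdeg F b)) 1 \<in> I" using IH b' by simp
    then have "single (m - exponent (mdeg F b)) 1 * single (exponent (mdeg F b)) 1 \<in> I"
      unfolding I by (rule module.span_scale[OF module_times])
    moreover have "m - exponent (mdeg F b) + exponent (mdeg F b) = m"
      using le[OF b] by (intro poly_mapping_eqI) (simp add: m_def lookup_add lookup_minus nat_mono)
    ultimately show ?thesis by (simp add: mult_single)
  qed
  have "mdeg F g x \<le> 1" for x
  proof (rule ccontr)
    assume "\<not> mdeg F g x \<le> 1"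
    then have two: "mdeg F g x \<ge> 2" by simp
    let ?X = "single (single x 1) 1 :: ('n, 'k) mpoly"
    obtain w where w: "w \<in> component F (Suc n)" "z = pscale ?X (bdry F w)"
    proof (cases n)
      case 0
      then obtain c where c: "z = single u (single m c)" "single m c \<in> I" using z0 by blast
      have mx: "lookup m x \<ge> 2" using two by (simp add: m_def)
      have "single u (single (m - single x 1) c) \<in> component F 0"
        by (simp add: minimal_component_0)
      moreover have "aug F (single u (single (m - single x 1) c)) \<in> I"
        using squarefree_monomial_ideal_divide_variable[OF sqf c(2) mx] by (simp add: minimal_u)
      ultimately obtain w where w: "w \<in> component F (Suc 0)"
        "bdry F w = single u (single (m - single x 1) c)"
        using aug_cycle_is_boundary[OF minimal_resolution] by (metis imageE)
      have "single x 1 + (m - single x 1) = m"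
      proof (rule poly_mapping_eqI)
        fix y
        show "lookup (single x 1 + (m - single x 1)) y = lookup m y"
          using mx by (cases "y = x") (auto simp: lookup_add lookup_minus lookup_single_not_eq)
      qed
      then show ?thesis
        using w c 0 by (intro that[of w]) (simp_all add: pscale_single mult_single)
    next
      case (Suc n')
      have "int (lookup (single x 1) y) \<le> mdeg F g y - mdeg F c y" if "c \<in> keys z" for c y
      proof -
        have "c \<in> gens F" "hdeg F c = n" using z(1) that by (auto simp: component_eq)
        then have "mdeg F c y \<le> 1" using Suc.hyps(1) by blast
        then show ?thesis
          using two le[OF that, of y] by (cases "y = x") (auto simp: lookup_single_not_eq)
      qed
      from homogeneous_divide_monomial[OF z(2) this] obtain y where
        y: "z = pscale ?X y" "keys y \<subseteq> keys z" by metis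
      have yc: "y \<in> component F n"
        using y(2) z(1) by (auto simp: component_eq)
      have "pscale ?X (bdry F y) = bdry F z"
        using yc component_subset_elems by (subst y(1), subst bdry_pscale[OF minimal_resolution]) auto
      also have "\<dots> = pscale ?X 0"
        using g component_subset_elems bdry_bdry[OF minimal_resolution] unfolding z_def by auto
      finally have "bdry F y = 0" by (rule pscale_monomial_cancel)
      then obtain w where "w \<in> component F (Suc n)" "y = bdry F w"
        using cycle_is_boundary[OF minimal_resolution] yc Suc by blast
      then show ?thesis using y(1) by (intro that) auto
    qed
    define v where "v = single g 1 - pscale ?X w"
    have "v \<in> component F (Suc n)"
      unfolding v_def using g w(1) by (intro component_closed)
    moreover have "bdry F v = 0"
    proof -
      have e: "single g 1 \<in> elems F" "w \<in> elems F"
        using g w(1) component_subset_elems by blast+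
      then show ?thesis
        using w(2) unfolding v_def z_def
        by (simp add: bdry_diff[OF minimal_resolution] bdry_pscale[OF minimal_resolution] elems_closed)
    qed
    ultimately have "lookup (lookup v g) 0 = 0" by (rule minimal_cycle_const_coeff)
    moreover have "lookup (?X * lookup w g) 0 = 0"
    proof -
      have "single x (Suc 0) \<noteq> 0" by (metis lookup_single_eq lookup_zero nat.distinct(1))
      then show ?thesis by (simp add: lookup_times_0 lookup_single when_def)
    qed
    ultimately show False
      by (simp add: v_def lookup_minus lookup_pscale)
  qed
  with nonneg in_I show ?case by (auto simp: m_def)
qed

end


section \<open>Every basis element occurs in a product\<close>

lemma dga_structureD:
  assumes "dga_structure F u mul"
  shows "a \<in> elems F \<Longrightarrow> linear_on (elems F) pscale pscale (mul a)"
    and "b \<in> elems F \<Longrightarrow> linear_on (elems F) pscale pscale (\<lambda>a. mul a b)"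
    and "a \<in> homogeneous F d \<Longrightarrow> b \<in> homogeneous F e \<Longrightarrow> mul a b \<in> homogeneous F (\<lambda>x. d x + e x)"
    and "a \<in> elems F \<Longrightarrow> mul (single u 1) a = a"
    and "a \<in> component F p \<Longrightarrow> b \<in> component F q \<Longrightarrow>
      bdry F (mul a b) = mul (bdry F a) b + pscale ((-1) ^ p) (mul a (bdry F b))"
    and "a \<in> component F p \<Longrightarrow> b \<in> component F q \<Longrightarrow> mul a b \<in> component F (p + q)"
    and "a \<in> elems F \<Longrightarrow> b \<in> elems F \<Longrightarrow> c \<in> elems F \<Longrightarrow> mul (mul a b) c = mul a (mul b c)"
proof -
  note D = assms[unfolded dga_structure_def]
  note D2 = conjunct2[OF D] note D3 = conjunct2[OF D2] note D4 = conjunct2[OF D3]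
  note D5 = conjunct2[OF D4] note D6 = conjunct2[OF D5] note D7 = conjunct2[OF D6]
  note D8 = conjunct2[OF D7] note D9 = conjunct2[OF conjunct2[OF D8]]
  show "a \<in> elems F \<Longrightarrow> linear_on (elems F) pscale pscale (mul a)"
    using conjunct1[OF D2] by blast
  show "b \<in> elems F \<Longrightarrow> linear_on (elems F) pscale pscale (\<lambda>a. mul a b)"
    using conjunct1[OF D3] by blast
  show "a \<in> homogeneous F d \<Longrightarrow> b \<in> homogeneous F e \<Longrightarrow> mul a b \<in> homogeneous F (\<lambda>x. d x + e x)"
    using conjunct1[OF D4] by blast
  show "a \<in> elems F \<Longrightarrow> mul (single u 1) a = a"
    using conjunct1[OF D6] by blast
  show "a \<in> component F p \<Longrightarrow> b \<in> component F q \<Longrightarrow>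
      bdry F (mul a b) = mul (bdry F a) b + pscale ((-1) ^ p) (mul a (bdry F b))"
    using conjunct1[OF D7] by blast
  show "a \<in> component F p \<Longrightarrow> b \<in> component F q \<Longrightarrow> mul a b \<in> component F (p + q)"
    using conjunct1[OF D8] by blast
  show "a \<in> elems F \<Longrightarrow> b \<in> elems F \<Longrightarrow> c \<in> elems F \<Longrightarrow> mul (mul a b) c = mul a (mul b c)"
    using D9 by blast
qed

text \<open>The case \<open>a = 0\<close> holds because \<open>u\<close> acts as the identity, and it is what the induction on \<open>b\<close> ends
  in: each step moves one factor \<open>e \<in> F\<^sub>1\<close> out of the left factor. Within \<open>F\<^sub>b\<close> a second induction runs
  over the total degree of the basis elements.\<close>

lemma functional_vanishing_on_products:
  fixes F :: "('n::finite, 'k::field) gcomplex"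
  assumes minimal: "minimal_free_resolution F u I"
    and sqf: "squarefree_monomial_ideal I"
    and dga: "dga_structure F u mul"
    and "a \<le> b" and "linear_on (component F b) pscale (*) \<phi>"
    and "\<And>p q. p \<in> component F a \<Longrightarrow> q \<in> component F (b - a) \<Longrightarrow> \<phi> (mul p q) = 0"
    and "v \<in> component F b"
  shows "\<phi> v = 0"
  using assms(4-7)
proof (induction b arbitrary: a \<phi> v)
  case 0
  have "single u 1 \<in> component F 0"
    using minimal_u[OF minimal] by (intro single_in_component)
  with 0 have "\<phi> (mul (single u 1) v) = 0" by simp
  then show ?case
    using dga_structureD(4)[OF dga] 0 component_subset_elems by (metis subsetD)
next
  case (Suc b)
  note res = minimal_resolution[OF minimal]
  note elemsI = component_subset_elems[THEN subsetD]
  note phi_expand = linear_on_expand[OF module_times Suc.prems(2)[unfolded component_eq]]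
  show ?case
  proof (cases a)
    case 0
    have "single u 1 \<in> component F 0"
      using minimal_u[OF minimal] by (intro single_in_component)
    with 0 Suc.prems have "\<phi> (mul (single u 1) v) = 0" by simp
    then show ?thesis
      using dga_structureD(4)[OF dga] Suc.prems(4) component_subset_elems by (metis subsetD)
  next
    case (Suc a')
    \<comment> \<open>The functional \<open>z \<mapsto> \<phi> (e * z)\<close> on \<open>F\<^sub>b\<close> kills \<open>p * q\<close>, since \<open>e * p \<in> F\<^sub>a\<close> for \<open>p \<in> F\<^sub>a\<^sub>-\<^sub>1\<close>.\<close>
    have left_mult: "\<phi> (mul e z) = 0" if e: "e \<in> component F 1" and z: "z \<in> component F b" for e z
    proof (rule Suc.IH[of a' "\<lambda>z. \<phi> (mul e z)"])
      show "a' \<le> b" using Suc Suc.prems(1) by simp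
      have "mul e y \<in> component F (Suc b)" if "y \<in> component F b" for y
        using dga_structureD(6)[OF dga e that] by simp
      with dga_structureD(1)[OF dga elemsI[OF e]] Suc.prems(2)
      show "linear_on (component F b) pscale (*) (\<lambda>z. \<phi> (mul e z))"
        by (simp add: linear_on_def elemsI)
      fix p q assume pq: "p \<in> component F a'" "q \<in> component F (b - a')"
      have "mul e p \<in> component F a"
        using dga_structureD(6)[OF dga e pq(1)] Suc by simp
      then have "\<phi> (mul (mul e p) q) = 0"
        using pq(2) Suc Suc.prems(3) by simp
      then show "\<phi> (mul e (mul p q)) = 0"
        using e pq by (simp add: dga_structureD(7)[OF dga] elemsI)
    qed (fact z)
    have basis: "\<phi> (single g 1) = 0" if "g \<in> gens F" "hdeg F g = Suc b" for g
      using that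
    proof (induction "nat (\<Sum>x\<in>UNIV. mdeg F g x)" arbitrary: g rule: less_induct)
      case less
      define W where "W = exponent (mdeg F g)"
      have g: "single g 1 \<in> component F (Suc b)"
        using less.prems by (intro single_in_component)
      have degree: "0 \<le> mdeg F h x" "mdeg F h x \<le> 1" if "h \<in> gens F" for h x
        using minimal_gen_degree[OF minimal sqf that] by auto
      have W: "int (lookup W x) = mdeg F g x" for x
        using degree[OF less.prems(1)] by (simp add: W_def)
      have "single W 1 \<in> I"
        using minimal_gen_degree[OF minimal sqf less.prems(1)] less.prems(2) by (simp add: W_def)
      then have "aug F (single u (single W 1)) \<in> I"
        by (simp add: minimal_u[OF minimal])
      moreover have uW: "single u (single W 1) \<in> component F 0"
        by (simp add: minimal_component_0[OF minimal])
      moreover have "single u (single W 1) \<in> homogeneous F (mdeg F g)"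
      proof -
        have "pscale (single W 1) (single u 1) \<in> homogeneous F (\<lambda>x. int (lookup W x) + mdeg F u x)"
          using minimal_u[OF minimal]
          by (intro homogeneous_pscale poly_homogeneous_single single_homogeneous)
        then show ?thesis
          by (simp add: pscale_single W minimal_u[OF minimal])
      qed
      ultimately obtain e where e: "e \<in> component F 1" "e \<in> homogeneous F (mdeg F g)"
        "bdry F e = single u (single W 1)"
        using homogeneous_aug_cycle_is_boundary[OF res] by (metis One_nat_def)
      define z where "z = bdry F (single g 1)"
      have z: "z \<in> component F b" "z \<in> homogeneous F (mdeg F g)" "bdry F z = 0"
        unfolding z_def using less.prems
        by (auto intro!: bdry_component[OF res g] bdry_homogeneous[OF res] single_homogeneous
          bdry_bdry[OF res] elemsI[OF g])
      have ez: "mul e z \<in> component F (Suc b)" "mul e z \<in> homogeneous F (\<lambda>x. mdeg F g x + mdeg F g x)"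
        using dga_structureD(6)[OF dga e(1) z(1)] dga_structureD(3)[OF dga e(2) z(2)] by simp_all
      \<comment> \<open>Where \<open>W\<close> is one, the exponent of the coefficient at \<open>c\<close> is at least \<open>2 - 1\<close>, as \<open>c\<close> is squarefree;
        where \<open>W\<close> is zero, nothing has to be divided out.\<close>
      have "int (lookup W x) \<le> mdeg F g x + mdeg F g x - mdeg F c x" if "c \<in> keys (mul e z)" for c x
      proof -
        have c: "c \<in> gens F" using ez(1) that by (auto simp: component_eq)
        have "lookup (mul e z) c \<in> poly_homogeneous (\<lambda>x. mdeg F g x + mdeg F g x - mdeg F c x)"
          using ez(2) by (simp add: homogeneous_iff)
        from poly_homogeneous_nonneg[OF this, of x] that
        have "mdeg F c x \<le> mdeg F g x + mdeg F g x" by (simp add: in_keys_iff)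
        then show ?thesis
          using degree[OF c, of x] degree[OF less.prems(1), of x] W[of x] by linarith
      qed
      from homogeneous_divide_monomial[OF ez(2) this] obtain y where
        y: "mul e z = pscale (single W 1) y" "keys y \<subseteq> keys (mul e z)"
        "y \<in> homogeneous F (\<lambda>x. mdeg F g x + mdeg F g x - int (lookup W x))" by metis
      have y_comp: "y \<in> component F (Suc b)"
        using y(2) ez(1) by (auto simp: component_eq)
      have y_hom: "y \<in> homogeneous F (mdeg F g)"
        using y(3) by (simp add: W)
      have "pscale (single W 1) (bdry F y) = bdry F (mul e z)"
        by (simp add: y(1) bdry_pscale[OF res elemsI[OF y_comp]])
      also have "\<dots> = mul (single u (single W 1)) z"
      proof -
        have "mul e 0 = 0"
          using linear_on_0[OF module_pscale dga_structureD(1)[OF dga elemsI[OF e(1)], unfolded elems_eq]] .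
        then show ?thesis
          by (simp add: dga_structureD(5)[OF dga e(1) z(1)] e(3) z(3))
      qed
      also have "\<dots> = pscale (single W 1) z"
      proof -
        have "mul (pscale (single W 1) (single u 1)) z = pscale (single W 1) (mul (single u 1) z)"
          using dga_structureD(2)[OF dga elemsI[OF z(1)]] minimal_u[OF minimal]
          by (simp add: linear_on_def single_in_elems)
        then show ?thesis
          by (simp add: pscale_single dga_structureD(4)[OF dga elemsI[OF z(1)]])
      qed
      finally have dy: "bdry F y = z" by (rule pscale_monomial_cancel)
      define w where "w = single g 1 - y"
      have w: "w \<in> component F (Suc b)" "w \<in> homogeneous F (mdeg F g)"
        unfolding w_def using g y_comp y_hom single_homogeneous[OF less.prems(1)]
        by (auto intro: component_closed homogeneous_diff)
      have "bdry F w = 0"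
        unfolding w_def using dy elemsI[OF g] elemsI[OF y_comp]
        by (simp add: bdry_diff[OF res] z_def)
      then have const: "lookup (lookup w c) 0 = 0" for c
        using minimal_cycle_const_coeff[OF minimal w(1)] by blast
      \<comment> \<open>A coefficient of \<open>w\<close> has no constant term, so it has positive degree and \<open>c\<close> has smaller degree
        than \<open>g\<close>.\<close>
      have "\<phi> (single c 1) = 0" if c: "c \<in> keys w" for c
      proof (rule less.hyps)
        show c': "c \<in> gens F" "hdeg F c = Suc b" using w(1) c by (auto simp: component_eq)
        have coeff: "lookup w c \<in> poly_homogeneous (\<lambda>x. mdeg F g x - mdeg F c x)"
          using w(2) by (simp add: homogeneous_iff)
        have le: "mdeg F c x \<le> mdeg F g x" for x
          using poly_homogeneous_nonneg[OF coeff, of x] c by (simp add: in_keys_iff)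
        have "\<exists>x. mdeg F c x \<noteq> mdeg F g x"
        proof (rule ccontr)
          assume "\<not> (\<exists>x. mdeg F c x \<noteq> mdeg F g x)"
          with coeff have "lookup w c \<in> poly_homogeneous (\<lambda>x. 0)" by simp
          then obtain k s where "lookup w c = single k s" "\<And>x. int (lookup k x) = 0"
            using c by (auto simp: poly_homogeneous_iff in_keys_iff)
          moreover from this(2) have "k = 0" by (intro poly_mapping_eqI) simp
          ultimately have "lookup w c = 0" using const[of c] by simp
          then show False using c by (simp add: in_keys_iff)
        qed
        then have "(\<Sum>x\<in>UNIV. mdeg F c x) < (\<Sum>x\<in>UNIV. mdeg F g x)"
          using le by (intro sum_strict_mono_ex1) (auto simp: order_less_le)
        moreover have "0 \<le> (\<Sum>x\<in>UNIV. mdeg F c x)"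
          using degree[OF c'(1)] by (intro sum_nonneg)
        ultimately show "nat (\<Sum>x\<in>UNIV. mdeg F c x) < nat (\<Sum>x\<in>UNIV. mdeg F g x)" by simp
      qed
      then have "\<phi> w = 0"
        using w(1) by (subst phi_expand) (auto simp: component_eq)
      moreover have "\<phi> (w + y) = \<phi> w + \<phi> y"
        using Suc.prems(2) w(1) y_comp by (simp add: linear_on_def)
      moreover have "\<phi> y = 0"
      proof -
        have "single W 1 * \<phi> y = \<phi> (mul e z)"
          using Suc.prems(2) y_comp by (simp add: y(1) linear_on_def)
        also have "\<dots> = single W 1 * 0"
          using left_mult[OF e(1) z(1)] by simp
        finally show ?thesis by (rule single_times_cancel)
      qed
      ultimately show ?case by (simp add: w_def)
    qed
    have "\<phi> (single c 1) = 0" if "c \<in> keys v" for c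
      using Suc.prems(4) that by (intro basis) (auto simp: component_eq)
    then show ?thesis
      using Suc.prems(4) by (subst phi_expand) (simp_all add: component_eq)
  qed
qed

text \<open>If the coefficient at \<open>g\<close> vanished on every product of basis elements, it would vanish on all
  products and hence at \<open>g\<close> itself.\<close>

lemma gen_occurs_in_product:
  fixes F :: "('n::finite, 'k::field) gcomplex"
  assumes minimal: "minimal_free_resolution F u I"
    and sqf: "squarefree_monomial_ideal I"
    and dga: "dga_structure F u mul"
    and a: "a \<le> hdeg F g" and g: "g \<in> gens F"
  obtains p q where "p \<in> gens F" "hdeg F p = a" "q \<in> gens F" "hdeg F q = hdeg F g - a"
    "lookup (mul (single p 1) (single q 1)) g \<noteq> 0"
proof -
  have "\<exists>p q. p \<in> gens F \<and> hdeg F p = a \<and> q \<in> gens F \<and> hdeg F q = hdeg F g - a \<and>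
    lookup (mul (single p 1) (single q 1)) g \<noteq> 0"
  proof (rule ccontr)
    assume none: "\<not> ?thesis"
    have "lookup (mul v w) g = 0" if v: "v \<in> component F a" and w: "w \<in> component F (hdeg F g - a)" for v w
    proof -
      have v': "v \<in> elems F" and w': "w \<in> elems F"
        using v w component_subset_elems by blast+
      have "mul v w = (\<Sum>p\<in>keys v. pscale (lookup v p) (mul (single p 1) w))"
        using linear_on_expand[OF module_pscale dga_structureD(2)[OF dga w', unfolded elems_eq]] v'
        by (simp add: elems_eq)
      moreover have "lookup (mul (single p 1) w) g = 0" if p: "p \<in> keys v" for p
      proof -
        have p': "p \<in> gens F" "hdeg F p = a" using v p by (auto simp: component_eq)
        have "mul (single p 1) w = (\<Sum>q\<in>keys w. pscale (lookup w q) (mul (single p 1) (single q 1)))"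
          using linear_on_expand[OF module_pscale
            dga_structureD(1)[OF dga single_in_elems[OF p'(1)], unfolded elems_eq]] w'
          by (simp add: elems_eq)
        moreover have "lookup (mul (single p 1) (single q 1)) g = 0" if "q \<in> keys w" for q
          using none p' w that by (auto simp: component_eq)
        ultimately show ?thesis by (simp add: lookup_sum lookup_pscale)
      qed
      ultimately show ?thesis by (simp add: lookup_sum lookup_pscale)
    qed
    note vanish = this
    have linear: "linear_on (component F (hdeg F g)) pscale (*) (\<lambda>v. lookup v g)"
      by (simp add: linear_on_def lookup_add lookup_pscale)
    have "lookup (single g (1 :: ('n, 'k) mpoly)) g = 0"
      using functional_vanishing_on_products[OF minimal sqf dga a linear vanish
        single_in_component[OF g refl]] .
    then show False by simp
  qed
  then show ?thesis using that by blast
qed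

lemma gen_degree_le_product:
  fixes F :: "('n::finite, 'k::field) gcomplex"
  assumes minimal: "minimal_free_resolution F u I"
    and sqf: "squarefree_monomial_ideal I"
    and dga: "dga_structure F u mul"
    and a: "a \<le> hdeg F g" and g: "g \<in> gens F"
  obtains p q where "p \<in> gens F" "hdeg F p = a" "q \<in> gens F" "hdeg F q = hdeg F g - a"
    "(\<Sum>x\<in>UNIV. mdeg F g x) \<le> (\<Sum>x\<in>UNIV. mdeg F p x) + (\<Sum>x\<in>UNIV. mdeg F q x)"
proof -
  obtain p q where pq: "p \<in> gens F" "hdeg F p = a" "q \<in> gens F" "hdeg F q = hdeg F g - a"
    and nz: "lookup (mul (single p 1) (single q 1)) g \<noteq> 0"
    using gen_occurs_in_product[OF assms] by blast
  have "mul (single p 1) (single q 1) \<in> homogeneous F (\<lambda>x. mdeg F p x + mdeg F q x)"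
    using pq by (intro dga_structureD(3)[OF dga] single_homogeneous)
  then have "lookup (mul (single p 1) (single q 1)) g
      \<in> poly_homogeneous (\<lambda>x. mdeg F p x + mdeg F q x - mdeg F g x)"
    by (simp add: homogeneous_iff)
  from poly_homogeneous_nonneg[OF this nz]
  have "(\<Sum>x\<in>UNIV. mdeg F g x) \<le> (\<Sum>x\<in>UNIV. mdeg F p x + mdeg F q x)"
    by (intro sum_mono) simp
  then show ?thesis
    using that[OF pq] by (simp add: sum.distrib)
qed


section \<open>Comparison of graded resolutions\<close>

lemma lin_ext_cong: "(\<And>b. b \<in> keys v \<Longrightarrow> f b = g b) \<Longrightarrow> lin_ext f v = lin_ext g v"
  by (simp add: lin_ext_def)

lemma lin_ext_0 [simp]: "lin_ext f 0 = 0"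
  by (simp add: lin_ext_def)

lemma lin_ext_unit: "lin_ext (\<lambda>b. single b 1) v = v"
  by (simp add: lin_ext_def sum_pscale_unit)

lemma lin_ext_diff_left: "lin_ext (\<lambda>b. f b - g b) v = lin_ext f v - lin_ext g v"
  by (simp add: lin_ext_def pscale_diff_right sum_subtractf)

lemma lin_ext_diff: "lin_ext f (v - w) = lin_ext f v - lin_ext f w"
  using lin_ext_add[of f "v - w" w] by simp

lemma lin_ext_sum: "lin_ext f (\<Sum>b\<in>B. g b) = (\<Sum>b\<in>B. lin_ext f (g b))"
  by (induction B rule: infinite_finite_induct) (simp_all add: lin_ext_add)

lemma lin_ext_lin_ext: "lin_ext f (lin_ext g v) = lin_ext (\<lambda>b. lin_ext f (g b)) v"
  by (simp add: lin_ext_def[of g] lin_ext_def[of "\<lambda>b. lin_ext f (g b)"] lin_ext_sum lin_ext_pscale)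

lemma bdry_eq_lin_ext:
  assumes "free_resolution P I" "v \<in> elems P"
  shows "bdry P v = lin_ext (\<lambda>b. bdry P (single b 1)) v"
  using linear_on_eq_lin_ext[OF bdry_linear[OF assms(1), unfolded elems_eq]] assms(2)
  by (simp add: elems_eq)

lemma bdry_lin_ext:
  assumes "free_resolution Q I" "\<And>b. b \<in> keys v \<Longrightarrow> f b \<in> elems Q"
  shows "bdry Q (lin_ext f v) = lin_ext (\<lambda>b. bdry Q (f b)) v"
proof -
  have "bdry Q (lin_ext f v) = (\<Sum>b\<in>keys v. bdry Q (pscale (lookup v b) (f b)))"
    unfolding lin_ext_def using assms(2) bdry_linear[OF assms(1), unfolded elems_eq]
    by (intro linear_on_sum[OF module_pscale]) (auto simp: elems_eq intro!: subset_trans[OF keys_pscale])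
  also have "\<dots> = (\<Sum>b\<in>keys v. pscale (lookup v b) (bdry Q (f b)))"
    using assms(2) by (intro sum.cong) (simp_all add: bdry_pscale[OF assms(1)])
  finally show ?thesis by (simp add: lin_ext_def)
qed

lemma bdry_gen_component:
  assumes "free_resolution P I" "b \<in> gens P" "hdeg P b = Suc n"
  shows "bdry P (single b 1) \<in> component P n"
  using bdry_component[OF assms(1)] single_in_component[OF assms(2,3)] by blast

lemma bdry_gen_homogeneous:
  assumes "free_resolution P I" "b \<in> gens P"
  shows "bdry P (single b 1) \<in> homogeneous P (mdeg P b)"
  using bdry_homogeneous[OF assms(1)] single_homogeneous[OF assms(2)] by blast

text \<open>A homomorphism out of a free module is given by its values on the basis and extended by \<open>lin_ext\<close>.
  The shift \<open>s\<close> is zero for chain maps and one for homotopies.\<close>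

definition graded_on_gens ::
    "('n::finite, 'k::field) gcomplex \<Rightarrow> ('n, 'k) gcomplex \<Rightarrow> nat \<Rightarrow> (nat \<Rightarrow> nat \<Rightarrow>\<^sub>0 ('n, 'k) mpoly) \<Rightarrow> bool" where
  "graded_on_gens P Q s f \<longleftrightarrow>
    (\<forall>b\<in>gens P. f b \<in> component Q (hdeg P b + s) \<and> f b \<in> homogeneous Q (mdeg P b))"

text \<open>The last condition says that the chain map lifts the identity of \<open>S/I\<close>.\<close>

definition graded_chain_map ::
    "('n::finite, 'k::field) gcomplex \<Rightarrow> ('n, 'k) gcomplex \<Rightarrow> ('n, 'k) mpoly set \<Rightarrow>
      (nat \<Rightarrow> nat \<Rightarrow>\<^sub>0 ('n, 'k) mpoly) \<Rightarrow> bool" where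
  "graded_chain_map P Q I f \<longleftrightarrow> graded_on_gens P Q 0 f \<and>
    (\<forall>v\<in>elems P. bdry Q (lin_ext f v) = lin_ext f (bdry P v)) \<and>
    (\<forall>v\<in>component P 0. aug Q (lin_ext f v) - aug P v \<in> I)"

lemma graded_on_gens_lin_ext:
  assumes "graded_on_gens P Q s f"
  shows "v \<in> component P i \<Longrightarrow> lin_ext f v \<in> component Q (i + s)"
    and "v \<in> homogeneous P d \<Longrightarrow> lin_ext f v \<in> homogeneous Q d"
    and "v \<in> elems P \<Longrightarrow> lin_ext f v \<in> elems Q"
proof -
  have f: "f b \<in> component Q (hdeg P b + s)" "f b \<in> homogeneous Q (mdeg P b)" if "b \<in> gens P" for b
    using assms that by (auto simp: graded_on_gens_def)
  then show "lin_ext f v \<in> component Q (i + s)" if "v \<in> component P i"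
    using that by (intro lin_ext_component[of P i f Q "i + s"]) auto
  show "lin_ext f v \<in> homogeneous Q d" if "v \<in> homogeneous P d"
    using f that by (intro lin_ext_homogeneous[of P f Q v d])
  show "lin_ext f v \<in> elems Q" if "v \<in> elems P"
    using f homogeneous_subset_elems that by (intro lin_ext_elems[of P f Q v]) blast+
qed

lemma squarefree_monomial_ideal_closed:
  assumes "squarefree_monomial_ideal I"
  shows "0 \<in> I" "f \<in> I \<Longrightarrow> g \<in> I \<Longrightarrow> f + g \<in> I" "f \<in> I \<Longrightarrow> s * f \<in> I"
    "f \<in> I \<Longrightarrow> g \<in> I \<Longrightarrow> f - g \<in> I"
    "(\<And>b. b \<in> B \<Longrightarrow> h b \<in> I) \<Longrightarrow> sum h B \<in> I"
proof -
  obtain M where I: "I = ideal_gen M"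
    using assms unfolding squarefree_monomial_ideal_def by blast
  show "0 \<in> I" "f \<in> I \<Longrightarrow> g \<in> I \<Longrightarrow> f + g \<in> I" "f \<in> I \<Longrightarrow> s * f \<in> I"
    "f \<in> I \<Longrightarrow> g \<in> I \<Longrightarrow> f - g \<in> I"
    "(\<And>b. b \<in> B \<Longrightarrow> h b \<in> I) \<Longrightarrow> sum h B \<in> I"
    unfolding I
    by (fact module.span_zero[OF module_times] module.span_add[OF module_times]
      module.span_scale[OF module_times] module.span_diff[OF module_times]
      module.span_sum[OF module_times])+
qed

lemma aug_linear: "free_resolution P I \<Longrightarrow> linear_on (component P 0) pscale (*) (aug P)"
  by (simp add: free_resolution_def)

lemma aug_expand:
  assumes "free_resolution P I" "v \<in> component P 0"
  shows "aug P v = (\<Sum>b\<in>keys v. lookup v b * aug P (single b 1))"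
  using linear_on_expand[OF module_times aug_linear[OF assms(1), unfolded component_eq]] assms(2)
  by (simp add: component_eq)

lemma aug_lin_ext:
  assumes "free_resolution Q I" "\<And>b. b \<in> keys v \<Longrightarrow> f b \<in> component Q 0"
  shows "aug Q (lin_ext f v) = (\<Sum>b\<in>keys v. lookup v b * aug Q (f b))"
proof -
  have "aug Q (lin_ext f v) = (\<Sum>b\<in>keys v. aug Q (pscale (lookup v b) (f b)))"
    unfolding lin_ext_def using assms(2) aug_linear[OF assms(1), unfolded component_eq]
    by (intro linear_on_sum[OF module_times]) (auto simp: component_eq dest: subsetD[OF keys_pscale])
  also have "\<dots> = (\<Sum>b\<in>keys v. lookup v b * aug Q (f b))"
    using assms(2) aug_linear[OF assms(1)] by (intro sum.cong) (simp_all add: linear_on_def)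
  finally show ?thesis .
qed

lemma aug_homogeneous:
  "free_resolution P I \<Longrightarrow> v \<in> component P 0 \<Longrightarrow> v \<in> homogeneous P d \<Longrightarrow> aug P v \<in> poly_homogeneous d"
  by (simp add: free_resolution_def)

lemma aug_hom_part:
  fixes P :: "('n::finite, 'k::field) gcomplex"
  assumes "free_resolution P I" "v \<in> component P 0"
  shows "aug P (hom_part P d v) = poly_part d (aug P v)"
proof (rule linear_map_hom_part[where G = "{b \<in> gens P. hdeg P b = 0}" and part = "poly_part d"])
  show "module ((*) :: ('n, 'k) mpoly \<Rightarrow> _)" by (rule module_times)
  show "linear_on {v. keys v \<subseteq> {b \<in> gens P. hdeg P b = 0}} pscale (*) (aug P)"
    using aug_linear[OF assms(1)] by (simp add: component_eq)
  show "poly_part d (aug P v) = (if d = e then aug P v else 0)"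
    if "keys v \<subseteq> {b \<in> gens P. hdeg P b = 0}" "v \<in> homogeneous P e" for e v
    using that by (intro poly_part_of_homogeneous aug_homogeneous[OF assms(1)]) (simp_all add: component_eq)
  show "keys v \<subseteq> {b \<in> gens P. hdeg P b = 0}" using assms(2) by (simp add: component_eq)
qed (auto simp: poly_part_add)

text \<open>The augmentation is surjective modulo \<open>I\<close>; the lift can be made homogeneous because a monomial ideal
  contains the homogeneous parts of its elements.\<close>

lemma graded_augmentation_lift:
  assumes "squarefree_monomial_ideal I" "free_resolution Q I" "f \<in> poly_homogeneous d"
  obtains y where "y \<in> component Q 0" "y \<in> homogeneous Q d" "aug Q y - f \<in> I"
proof -
  have "\<forall>f. \<exists>v\<in>component Q 0. f - aug Q v \<in> I"
    using assms(2) by (simp add: free_resolution_def)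
  then obtain v where v: "v \<in> component Q 0" "f - aug Q v \<in> I" by blast
  have "poly_part d (f - aug Q v) \<in> I"
    by (rule squarefree_monomial_ideal_poly_part[OF assms(1) v(2)])
  moreover have "poly_part d (f - aug Q v) = f - aug Q (hom_part Q d v)"
    by (simp add: poly_part_diff poly_part_of_homogeneous[OF assms(3)] aug_hom_part[OF assms(2) v(1)])
  ultimately have "0 - (f - aug Q (hom_part Q d v)) \<in> I"
    using squarefree_monomial_ideal_closed(1,4)[OF assms(1)] by metis
  then have "aug Q (hom_part Q d v) - f \<in> I" by simp
  moreover have "v \<in> elems Q" using v(1) component_subset_elems by blast
  ultimately show ?thesis
    using v(1) by (intro that[of "hom_part Q d v"] hom_part_component hom_part_homogeneous)
qed

text \<open>Recursion on the homological degree. Once \<open>f\<close> is known in lower degrees, the image of \<open>\<partial>b\<close> is a cycle,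
  or an element of \<open>Q\<^sub>0\<close> with augmentation in \<open>I\<close>, and exactness of \<open>Q\<close> provides a homogeneous
  preimage as the value at \<open>b\<close>.\<close>

lemma graded_chain_map_exists:
  fixes P Q :: "('n::finite, 'k::field) gcomplex"
  assumes sqf: "squarefree_monomial_ideal I" and P: "free_resolution P I" and Q: "free_resolution Q I"
  shows "\<exists>f. graded_chain_map P Q I f"
proof -
  \<comment> \<open>\<open>y\<close> is an admissible value at \<open>b\<close> when \<open>f\<close> gives the values in lower homological degree.\<close>
  define good where "good f b y \<longleftrightarrow> (b \<in> gens P \<longrightarrow>
      y \<in> component Q (hdeg P b) \<and> y \<in> homogeneous Q (mdeg P b) \<and>
      (if hdeg P b = 0 then aug Q y - aug P (single b 1) \<in> I
       else bdry Q y = lin_ext f (bdry P (single b 1))))" for f b y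
  have bdry_keys: "c \<in> gens P \<and> Suc (hdeg P c) = hdeg P b"
    if "b \<in> gens P" "hdeg P b \<noteq> 0" "c \<in> keys (bdry P (single b 1))" for b c
    using bdry_gen_component[OF P that(1), of "hdeg P b - 1"] that by (auto simp: component_eq)
  have "\<exists>f. \<forall>b. good f b (f b)"
  proof (rule dependent_wf_choice[of "measure (hdeg P)"])
    fix f g :: "nat \<Rightarrow> nat \<Rightarrow>\<^sub>0 ('n, 'k) mpoly" and b y
    assume eq: "\<And>c. (c, b) \<in> measure (hdeg P) \<Longrightarrow> f c = g c"
    have "lin_ext f (bdry P (single b 1)) = lin_ext g (bdry P (single b 1))"
      if "b \<in> gens P" "hdeg P b \<noteq> 0"
    proof (rule lin_ext_cong)
      fix c assume "c \<in> keys (bdry P (single b 1))"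
      from bdry_keys[OF that this] show "f c = g c" by (intro eq) auto
    qed
    then show "good f b y = good g b y" unfolding good_def by auto
  next
    fix b f
    assume IH: "\<And>c. (c, b) \<in> measure (hdeg P) \<Longrightarrow> good f c (f c)"
    show "\<exists>y. good f b y"
    proof (cases "b \<in> gens P")
      case False
      then show ?thesis by (simp add: good_def)
    next
      case b: True
      show ?thesis
      proof (cases "hdeg P b")
        case 0
        have "aug P (single b 1) \<in> poly_homogeneous (mdeg P b)"
          using b 0 by (intro aug_homogeneous[OF P] single_in_component single_homogeneous)
        then obtain y where "y \<in> component Q 0" "y \<in> homogeneous Q (mdeg P b)"
          "aug Q y - aug P (single b 1) \<in> I"
          using graded_augmentation_lift[OF sqf Q] by blast
        then show ?thesis using 0 by (auto simp: good_def)
      next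
        case (Suc n)
        define v where "v = bdry P (single b 1)"
        have v: "v \<in> component P n" "v \<in> homogeneous P (mdeg P b)"
          unfolding v_def using b Suc by (auto intro: bdry_gen_component[OF P] bdry_gen_homogeneous[OF P])
        have keys: "c \<in> gens P" "hdeg P c = n" if "c \<in> keys v" for c
          using v(1) that by (auto simp: component_eq)
        have good: "good f c (f c)" if "c \<in> keys v" for c
          using keys[OF that] Suc by (intro IH) simp
        have comp: "f c \<in> component Q n" if "c \<in> keys v" for c
          using good[OF that] keys[OF that] by (simp add: good_def)
        have z_comp: "lin_ext f v \<in> component Q n"
          unfolding lin_ext_def using comp by (intro component_closed)
        have z_hom: "lin_ext f v \<in> homogeneous Q (mdeg P b)"
          unfolding lin_ext_def
        proof (rule homogeneous_sum)
          fix c assume c: "c \<in> keys v"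
          have "f c \<in> homogeneous Q (mdeg P c)"
            using good[OF c] keys[OF c] by (simp add: good_def)
          moreover have "lookup v c \<in> poly_homogeneous (\<lambda>x. mdeg P b x - mdeg P c x)"
            using v(2) by (simp add: homogeneous_iff)
          ultimately show "pscale (lookup v c) (f c) \<in> homogeneous Q (mdeg P b)"
            using homogeneous_pscale by fastforce
        qed
        have "\<exists>y. y \<in> component Q (Suc n) \<and> y \<in> homogeneous Q (mdeg P b) \<and> bdry Q y = lin_ext f v"
        proof (cases n)
          case 0
          have "aug Q (lin_ext f v) - aug P v
              = (\<Sum>c\<in>keys v. lookup v c * (aug Q (f c) - aug P (single c 1)))"
            using v(1) comp 0
            by (simp add: aug_lin_ext[OF Q] aug_expand[OF P] sum_subtractf right_diff_distrib)
          also have "\<dots> \<in> I"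
            using good keys 0 by (intro squarefree_monomial_ideal_closed(3,5)[OF sqf]) (simp add: good_def)
          finally have "aug Q (lin_ext f v) - aug P v + aug P v \<in> I"
            using aug_bdry[OF P single_in_component[OF b]] Suc 0 unfolding v_def
            by (intro squarefree_monomial_ideal_closed(2)[OF sqf]) simp_all
          then show ?thesis
            using homogeneous_aug_cycle_is_boundary[OF Q _ z_hom] z_comp 0 by (metis diff_add_cancel)
        next
          case (Suc n')
          have "bdry Q (lin_ext f v) = lin_ext (\<lambda>c. bdry Q (f c)) v"
            using comp component_subset_elems by (intro bdry_lin_ext[OF Q]) blast
          also have "\<dots> = lin_ext (\<lambda>c. lin_ext f (bdry P (single c 1))) v"
            using good keys Suc by (intro lin_ext_cong) (simp add: good_def)
          also have "\<dots> = lin_ext f (bdry P v)"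
            using v(1) component_subset_elems
            by (subst bdry_eq_lin_ext[OF P, of v]) (auto simp: lin_ext_lin_ext)
          also have "bdry P v = 0"
            unfolding v_def using b by (intro bdry_bdry[OF P] single_in_elems)
          finally show ?thesis
            using homogeneous_cycle_is_boundary[OF Q _ z_hom] z_comp Suc by (metis lin_ext_0)
        qed
        then show ?thesis using Suc by (auto simp: good_def v_def)
      qed
    qed
  qed simp
  then obtain f where f: "\<And>b. good f b (f b)" by blast
  have graded: "graded_on_gens P Q 0 f"
    using f by (auto simp: graded_on_gens_def good_def)
  have chain: "bdry Q (lin_ext f v) = lin_ext f (bdry P v)" if v: "v \<in> elems P" for v
  proof -
    have "f c \<in> elems Q" if "c \<in> keys v" for c
      using graded v that component_subset_elems unfolding graded_on_gens_def elems_eq[of P] by blast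
    then have "bdry Q (lin_ext f v) = lin_ext (\<lambda>c. bdry Q (f c)) v"
      by (rule bdry_lin_ext[OF Q])
    also have "\<dots> = lin_ext (\<lambda>c. lin_ext f (bdry P (single c 1))) v"
    proof (rule lin_ext_cong)
      fix c assume "c \<in> keys v"
      with v have c: "c \<in> gens P" by (auto simp: elems_eq)
      show "bdry Q (f c) = lin_ext f (bdry P (single c 1))"
      proof (cases "hdeg P c = 0")
        case True
        then show ?thesis
          using c f[of c] bdry_component_0[OF Q] bdry_component_0[OF P single_in_component[OF c]]
          by (simp add: good_def)
      next
        case False
        then show ?thesis using c f[of c] by (simp add: good_def)
      qed
    qed
    also have "\<dots> = lin_ext f (bdry P v)"
      by (subst bdry_eq_lin_ext[OF P v]) (simp add: lin_ext_lin_ext)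
    finally show ?thesis .
  qed
  have "aug Q (lin_ext f v) - aug P v \<in> I" if v: "v \<in> component P 0" for v
  proof -
    have c: "c \<in> gens P \<and> hdeg P c = 0" if "c \<in> keys v" for c
      using v that by (auto simp: component_eq)
    have comp: "f c \<in> component Q 0" if "c \<in> keys v" for c
      using c[OF that] f[of c] by (simp add: good_def)
    have "aug Q (lin_ext f v) - aug P v = (\<Sum>c\<in>keys v. lookup v c * (aug Q (f c) - aug P (single c 1)))"
      using v by (simp add: aug_lin_ext[OF Q comp] aug_expand[OF P] sum_subtractf right_diff_distrib)
    also have "\<dots> \<in> I"
    proof (intro squarefree_monomial_ideal_closed(3,5)[OF sqf])
      fix c assume "c \<in> keys v"
      from c[OF this] show "aug Q (f c) - aug P (single c 1) \<in> I"
        using f[of c] by (simp add: good_def)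
    qed
    finally show ?thesis .
  qed
  with graded chain show ?thesis unfolding graded_chain_map_def by blast
qed

text \<open>The recursion of the previous lemma, one degree higher: the value at \<open>b\<close> is a homogeneous preimage of
  \<open>\<gamma> b - h (\<partial>b)\<close>, which is a cycle because \<open>\<gamma>\<close> is a chain map, or has augmentation in \<open>I\<close> because
  \<open>\<gamma>\<close> lifts the zero map of \<open>S/I\<close>.\<close>

lemma null_homotopy_exists:
  fixes P :: "('n::finite, 'k::field) gcomplex"
  assumes P: "free_resolution P I"
    and graded: "graded_on_gens P P 0 \<gamma>"
    and chain: "\<And>v. v \<in> elems P \<Longrightarrow> bdry P (lin_ext \<gamma> v) = lin_ext \<gamma> (bdry P v)"
    and aug: "\<And>v. v \<in> component P 0 \<Longrightarrow> aug P (lin_ext \<gamma> v) \<in> I"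
  shows "\<exists>h. graded_on_gens P P 1 h \<and>
    (\<forall>v\<in>elems P. bdry P (lin_ext h v) = lin_ext \<gamma> v - lin_ext h (bdry P v))"
proof -
  define good where "good h b y \<longleftrightarrow> (b \<in> gens P \<longrightarrow>
      y \<in> component P (Suc (hdeg P b)) \<and> y \<in> homogeneous P (mdeg P b) \<and>
      bdry P y = \<gamma> b - lin_ext h (bdry P (single b 1)))" for h b y
  have bdry_keys: "c \<in> gens P \<and> Suc (hdeg P c) = hdeg P b"
    if "b \<in> gens P" "c \<in> keys (bdry P (single b 1))" for b c
  proof (cases "hdeg P b")
    case 0
    then show ?thesis
      using bdry_component_0[OF P single_in_component[OF that(1)]] that(2) by simp
  next
    case (Suc n)
    then show ?thesis
      using bdry_gen_component[OF P that(1) Suc] that(2) by (auto simp: component_eq)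
  qed
  have \<gamma>: "\<gamma> b \<in> component P (hdeg P b)" "\<gamma> b \<in> homogeneous P (mdeg P b)" if "b \<in> gens P" for b
    using graded that by (auto simp: graded_on_gens_def)
  have extend: "bdry P (lin_ext h v) = lin_ext \<gamma> v - lin_ext h (bdry P v)"
    if v: "v \<in> elems P" and good: "\<And>c. c \<in> keys v \<Longrightarrow> good h c (h c)" for h v
  proof -
    have gens: "c \<in> gens P" if "c \<in> keys v" for c
      using v that by (auto simp: elems_eq)
    have "h c \<in> elems P" if "c \<in> keys v" for c
      using good[OF that] gens[OF that] component_subset_elems unfolding good_def by blast
    then have "bdry P (lin_ext h v) = lin_ext (\<lambda>c. bdry P (h c)) v"
      by (rule bdry_lin_ext[OF P])
    also have "\<dots> = lin_ext (\<lambda>c. \<gamma> c - lin_ext h (bdry P (single c 1))) v"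
      using good gens by (intro lin_ext_cong) (simp add: good_def)
    also have "\<dots> = lin_ext \<gamma> v - lin_ext h (bdry P v)"
      by (subst bdry_eq_lin_ext[OF P v]) (simp add: lin_ext_lin_ext lin_ext_diff_left)
    finally show ?thesis .
  qed
  have "\<exists>h. \<forall>b. good h b (h b)"
  proof (rule dependent_wf_choice[of "measure (hdeg P)"])
    fix f g :: "nat \<Rightarrow> nat \<Rightarrow>\<^sub>0 ('n, 'k) mpoly" and b y
    assume eq: "\<And>c. (c, b) \<in> measure (hdeg P) \<Longrightarrow> f c = g c"
    have "lin_ext f (bdry P (single b 1)) = lin_ext g (bdry P (single b 1))" if "b \<in> gens P"
    proof (rule lin_ext_cong)
      fix c assume "c \<in> keys (bdry P (single b 1))"
      from bdry_keys[OF that this] show "f c = g c" by (intro eq) auto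
    qed
    then show "good f b y = good g b y" unfolding good_def by auto
  next
    fix b h
    assume IH: "\<And>c. (c, b) \<in> measure (hdeg P) \<Longrightarrow> good h c (h c)"
    show "\<exists>y. good h b y"
    proof (cases "b \<in> gens P")
      case False
      then show ?thesis by (simp add: good_def)
    next
      case b: True
      define v where "v = bdry P (single b 1)"
      have v_hom: "v \<in> homogeneous P (mdeg P b)"
        unfolding v_def by (rule bdry_gen_homogeneous[OF P b])
      have keys: "c \<in> gens P" "Suc (hdeg P c) = hdeg P b" if "c \<in> keys v" for c
        using bdry_keys[OF b] that unfolding v_def by blast+
      have good: "good h c (h c)" if "c \<in> keys v" for c
        using keys[OF that] by (intro IH) simp
      have comp: "lin_ext h v \<in> component P (hdeg P b)"
        unfolding lin_ext_def using good keys by (intro component_closed) (simp add: good_def)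
      have hom: "lin_ext h v \<in> homogeneous P (mdeg P b)"
        unfolding lin_ext_def
      proof (rule homogeneous_sum)
        fix c assume c: "c \<in> keys v"
        have "h c \<in> homogeneous P (mdeg P c)"
          using good[OF c] keys[OF c] by (simp add: good_def)
        moreover have "lookup v c \<in> poly_homogeneous (\<lambda>x. mdeg P b x - mdeg P c x)"
          using v_hom by (simp add: homogeneous_iff)
        ultimately show "pscale (lookup v c) (h c) \<in> homogeneous P (mdeg P b)"
          using homogeneous_pscale by fastforce
      qed
      define z where "z = \<gamma> b - lin_ext h v"
      have z: "z \<in> component P (hdeg P b)" "z \<in> homogeneous P (mdeg P b)"
        unfolding z_def using \<gamma>[OF b] comp hom by (auto intro: component_closed homogeneous_diff)
      have "\<exists>y. y \<in> component P (Suc (hdeg P b)) \<and> y \<in> homogeneous P (mdeg P b) \<and> bdry P y = z"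
      proof (cases "hdeg P b")
        case 0
        then have "v = 0"
          unfolding v_def using bdry_component_0[OF P] single_in_component[OF b] by simp
        then have "aug P z \<in> I"
          using aug[OF single_in_component[OF b 0, of 1]] by (simp add: z_def lin_ext_single)
        then show ?thesis
          using homogeneous_aug_cycle_is_boundary[OF P _ z(2)] z(1) 0 by metis
      next
        case (Suc n)
        have v: "v \<in> elems P"
          using v_hom homogeneous_subset_elems by blast
        have "bdry P v = 0"
          unfolding v_def using b by (intro bdry_bdry[OF P] single_in_elems)
        then have "bdry P (lin_ext h v) = lin_ext \<gamma> v"
          using extend[OF v good] by simp
        moreover have "bdry P (\<gamma> b) = lin_ext \<gamma> v"
          using chain[OF single_in_elems[OF b, of 1]] by (simp add: lin_ext_single v_def)
        ultimately have "bdry P z = 0"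
          using \<gamma>(1)[OF b] comp component_subset_elems unfolding z_def
          by (subst bdry_diff[OF P]) auto
        then show ?thesis
          using homogeneous_cycle_is_boundary[OF P _ z(2)] z(1) Suc by metis
      qed
      then show ?thesis by (auto simp: good_def z_def v_def)
    qed
  qed simp
  then obtain h where h: "\<And>b. good h b (h b)" by blast
  have "graded_on_gens P P 1 h"
    using h by (auto simp: graded_on_gens_def good_def)
  with extend h show ?thesis by blast
qed

text \<open>Both \<open>g \<circ> f\<close> and the identity of \<open>P\<close> lift the identity of \<open>S/I\<close>, so their difference is null-homotopic.\<close>

lemma graded_homotopy_equivalence:
  fixes P Q :: "('n::finite, 'k::field) gcomplex"
  assumes sqf: "squarefree_monomial_ideal I" and P: "free_resolution P I" and Q: "free_resolution Q I"
  obtains f g h where "graded_chain_map P Q I f" "graded_chain_map Q P I g" "graded_on_gens P P 1 h"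
    "\<And>v. v \<in> elems P \<Longrightarrow>
      lin_ext g (lin_ext f v) = v + bdry P (lin_ext h v) + lin_ext h (bdry P v)"
proof -
  obtain f where f: "graded_chain_map P Q I f"
    using graded_chain_map_exists[OF sqf P Q] by blast
  obtain g where g: "graded_chain_map Q P I g"
    using graded_chain_map_exists[OF sqf Q P] by blast
  have fg: "graded_on_gens P Q 0 f" "graded_on_gens Q P 0 g"
    using f g by (auto simp: graded_chain_map_def)
  define \<gamma> where "\<gamma> b = lin_ext g (f b) - single b 1" for b
  have \<gamma>: "lin_ext \<gamma> v = lin_ext g (lin_ext f v) - v" for v
    unfolding \<gamma>_def by (simp add: lin_ext_diff_left lin_ext_unit lin_ext_lin_ext)
  have "graded_on_gens P P 0 \<gamma>"
    unfolding graded_on_gens_def \<gamma>_def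
  proof (intro ballI conjI)
    fix b assume b: "b \<in> gens P"
    have fb: "f b \<in> component Q (hdeg P b)" "f b \<in> homogeneous Q (mdeg P b)"
      using fg(1) b by (auto simp: graded_on_gens_def)
    show "lin_ext g (f b) - single b 1 \<in> component P (hdeg P b + 0)"
      using graded_on_gens_lin_ext(1)[OF fg(2) fb(1)] b
      by (intro component_closed) (simp_all add: single_in_component)
    show "lin_ext g (f b) - single b 1 \<in> homogeneous P (mdeg P b)"
      using graded_on_gens_lin_ext(2)[OF fg(2) fb(2)] b
      by (intro homogeneous_diff single_homogeneous)
  qed
  moreover have "bdry P (lin_ext \<gamma> v) = lin_ext \<gamma> (bdry P v)" if v: "v \<in> elems P" for v
  proof -
    have fv: "lin_ext f v \<in> elems Q" using graded_on_gens_lin_ext(3)[OF fg(1) v] .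
    have "bdry P (lin_ext g (lin_ext f v)) = lin_ext g (lin_ext f (bdry P v))"
      using f g v fv by (simp add: graded_chain_map_def)
    then show ?thesis
      using v graded_on_gens_lin_ext(3)[OF fg(2) fv] by (simp add: \<gamma> bdry_diff[OF P])
  qed
  moreover have "aug P (lin_ext \<gamma> v) \<in> I" if v: "v \<in> component P 0" for v
  proof -
    have fv: "lin_ext f v \<in> component Q 0"
      using graded_on_gens_lin_ext(1)[OF fg(1) v] by simp
    have gfv: "lin_ext g (lin_ext f v) \<in> component P 0"
      using graded_on_gens_lin_ext(1)[OF fg(2) fv] by simp
    have "aug P (lin_ext g (lin_ext f v) - v + v) = aug P (lin_ext g (lin_ext f v) - v) + aug P v"
      using aug_linear[OF P] gfv v component_closed(3)[OF gfv v] unfolding linear_on_def by blast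
    then have "aug P (lin_ext \<gamma> v) =
        (aug P (lin_ext g (lin_ext f v)) - aug Q (lin_ext f v)) + (aug Q (lin_ext f v) - aug P v)"
      by (simp add: \<gamma>)
    also have "\<dots> \<in> I"
      using f g v fv unfolding graded_chain_map_def
      by (intro squarefree_monomial_ideal_closed(2)[OF sqf]) blast+
    finally show ?thesis .
  qed
  ultimately obtain h where h: "graded_on_gens P P 1 h"
    "\<And>v. v \<in> elems P \<Longrightarrow> bdry P (lin_ext h v) = lin_ext \<gamma> v - lin_ext h (bdry P v)"
    using null_homotopy_exists[OF P] by blast
  show ?thesis
    by (rule that[OF f g h(1)]) (simp add: h(2) \<gamma>)
qed


section \<open>Betti numbers count basis elements\<close>

text \<open>Reduction of coefficients is the projection of a free module \<open>P\<close> onto \<open>P \<otimes> k\<close>; lifting along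
  \<open>k \<subseteq> S\<close> is a \<open>k\<close>-linear section of it.\<close>

definition const_red :: "('b \<Rightarrow>\<^sub>0 ('n::finite, 'k::field) mpoly) \<Rightarrow> ('b \<Rightarrow>\<^sub>0 'k)" where
  "const_red v = Poly_Mapping.map (\<lambda>f. lookup f 0) v"

definition const_lift :: "('b \<Rightarrow>\<^sub>0 'k) \<Rightarrow> ('b \<Rightarrow>\<^sub>0 ('n::finite, 'k::field) mpoly)" where
  "const_lift w = Poly_Mapping.map (\<lambda>c. single 0 c) w"

lemma lookup_const_red: "lookup (const_red v) b = lookup (lookup v b) 0"
  by (simp add: const_red_def map.rep_eq when_def)

lemma lookup_const_lift: "lookup (const_lift w) b = single 0 (lookup w b)"
  by (simp add: const_lift_def map.rep_eq when_def)

lemma diff_k_eq: "diff_k P w = const_red (bdry P (const_lift w))"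
  by (simp add: diff_k_def const_red_def const_lift_def)

lemma const_red_const_lift [simp]: "const_red (const_lift w) = w"
  by (rule poly_mapping_eqI) (simp add: lookup_const_red lookup_const_lift)

lemma const_red_add: "const_red (v + w) = const_red v + const_red w"
  by (rule poly_mapping_eqI) (simp add: lookup_const_red lookup_add)

lemma const_red_diff: "const_red (v - w) = const_red v - const_red w"
  by (rule poly_mapping_eqI) (simp add: lookup_const_red lookup_minus)

lemma const_red_0 [simp]: "const_red 0 = 0"
  by (rule poly_mapping_eqI) (simp add: lookup_const_red)

lemma const_red_pscale: "const_red (pscale s v) = pscale (lookup s 0) (const_red v)"
  by (rule poly_mapping_eqI) (simp add: lookup_const_red lookup_pscale lookup_times_0)

lemma const_lift_add: "const_lift (v + w) = const_lift v + const_lift w"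
  by (rule poly_mapping_eqI) (simp add: lookup_const_lift lookup_add single_add)

lemma const_lift_0 [simp]: "const_lift 0 = 0"
  by (rule poly_mapping_eqI) (simp add: lookup_const_lift)

lemma const_lift_pscale: "const_lift (pscale c w) = pscale (single 0 c) (const_lift w)"
  by (rule poly_mapping_eqI) (simp add: lookup_const_lift lookup_pscale mult_single)

lemma keys_const_lift: "keys (const_lift w) \<subseteq> keys w"
proof
  fix b show "b \<in> keys w" if "b \<in> keys (const_lift w)"
    using that unfolding in_keys_iff lookup_const_lift by (metis single_zero)
qed

lemma const_red_lin_ext_eq_0:
  assumes "const_red v = 0"
  shows "const_red (lin_ext f v) = 0"
proof (rule poly_mapping_eqI)
  fix c
  have "lookup (lookup v b) 0 = 0" for b
    using assms by (metis lookup_const_red lookup_zero)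
  then show "lookup (const_red (lin_ext f v)) c = lookup 0 c"
    by (simp add: lin_ext_def lookup_const_red lookup_sum lookup_pscale lookup_times_0)
qed

lemma const_red_lin_ext_cong:
  assumes "const_red v = const_red w"
  shows "const_red (lin_ext f v) = const_red (lin_ext f w)"
  using const_red_lin_ext_eq_0[of "v - w" f] assms by (simp add: const_red_diff lin_ext_diff)

lemma const_red_bdry_cong:
  assumes "free_resolution P I" "v \<in> elems P" "w \<in> elems P" "const_red v = const_red w"
  shows "const_red (bdry P v) = const_red (bdry P w)"
  unfolding bdry_eq_lin_ext[OF assms(1,2)] bdry_eq_lin_ext[OF assms(1,3)]
  by (rule const_red_lin_ext_cong[OF assms(4)])

lemma tensor_k_lift:
  assumes "w \<in> tensor_k P i j"
  shows "const_lift w \<in> component P i" "const_lift w \<in> elems P"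
  using assms keys_const_lift[of w] by (auto simp: tensor_k_def component_eq elems_eq)

lemma tensor_k_0: "0 \<in> tensor_k P i j"
  by (simp add: tensor_k_def)

lemma tensor_k_add: "v \<in> tensor_k P i j \<Longrightarrow> w \<in> tensor_k P i j \<Longrightarrow> v + w \<in> tensor_k P i j"
  unfolding tensor_k_def by (rule keys_subset_add)

lemma tensor_k_pscale: "v \<in> tensor_k P i j \<Longrightarrow> pscale c v \<in> tensor_k P i j"
  unfolding tensor_k_def by (rule keys_subset_pscale)

text \<open>A coefficient of \<open>f b\<close> with nonzero constant term belongs to a basis element of the same multidegree
  as \<open>b\<close>, so a degree-preserving map still preserves degrees after reduction.\<close>

lemma const_red_lin_ext_tensor_k:
  fixes P Q :: "('n::finite, 'k::field) gcomplex"
  assumes w: "w \<in> tensor_k P i j"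
    and f: "\<And>b. b \<in> gens P \<Longrightarrow> hdeg P b = i \<Longrightarrow> f b \<in> component Q i' \<and> f b \<in> homogeneous Q (mdeg P b)"
  shows "const_red (lin_ext f (const_lift w)) \<in> tensor_k Q i' j"
  unfolding tensor_k_def
proof (rule CollectI, rule subsetI)
  fix c assume "c \<in> keys (const_red (lin_ext f (const_lift w)))"
  then have "lookup (lookup (lin_ext f (const_lift w)) c) 0 \<noteq> 0"
    by (simp add: in_keys_iff lookup_const_red)
  then have "(\<Sum>b\<in>keys (const_lift w :: nat \<Rightarrow>\<^sub>0 ('n, 'k) mpoly). lookup w b * lookup (lookup (f b) c) 0) \<noteq> 0"
    by (simp add: lin_ext_def lookup_sum lookup_pscale lookup_times_0 lookup_const_lift)
  then obtain b where b: "b \<in> keys (const_lift w :: nat \<Rightarrow>\<^sub>0 ('n, 'k) mpoly)" "lookup (lookup (f b) c) 0 \<noteq> 0"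
    by (metis (no_types, lifting) mult_zero_right sum.neutral)
  from subsetD[OF keys_const_lift b(1)] have b': "b \<in> gens P" "hdeg P b = i" "(\<Sum>x\<in>UNIV. mdeg P b x) = j"
    using w by (auto simp: tensor_k_def)
  have "lookup (f b) c \<noteq> 0" using b(2) by auto
  then have "c \<in> gens Q" "hdeg Q c = i'"
    using f[OF b'(1,2)] by (auto simp: component_eq in_keys_iff)
  moreover have "mdeg P b x - mdeg Q c x = 0" for x
    using f[OF b'(1,2)] b(2) by (intro poly_homogeneous_lookup_0[of "lookup (f b) c"]) (simp_all add: homogeneous_iff)
  then have "(\<Sum>x\<in>UNIV. mdeg Q c x) = j"
    using b'(3) by simp
  ultimately show "c \<in> {b \<in> gens Q. hdeg Q b = i' \<and> (\<Sum>x\<in>UNIV. mdeg Q b x) = j}" by simp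
qed

lemma diff_k_tensor_k:
  assumes P: "free_resolution P I" and w: "w \<in> tensor_k P (Suc i) j"
  shows "diff_k P w \<in> tensor_k P i j"
proof -
  have "const_red (lin_ext (\<lambda>b. bdry P (single b 1)) (const_lift w)) \<in> tensor_k P i j"
    using bdry_gen_component[OF P] bdry_gen_homogeneous[OF P]
    by (intro const_red_lin_ext_tensor_k[OF w]) auto
  then show ?thesis
    by (simp add: diff_k_eq bdry_eq_lin_ext[OF P tensor_k_lift(2)[OF w]])
qed

text \<open>The differential of \<open>P \<otimes> k\<close> may be computed on any lift, not only on the constant one.\<close>

lemma diff_k_const_red:
  assumes P: "free_resolution P I" and "const_red v \<in> tensor_k P i j" "v \<in> elems P"
  shows "diff_k P (const_red v) = const_red (bdry P v)"
  unfolding diff_k_eq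
  using assms by (intro const_red_bdry_cong[OF P]) (auto dest: tensor_k_lift)

lemma diff_k_diff_k:
  assumes P: "free_resolution P I" and w: "w \<in> tensor_k P (Suc i) j"
  shows "diff_k P (diff_k P w) = 0"
proof -
  have "const_red (bdry P (const_lift w)) \<in> tensor_k P i j"
    using diff_k_tensor_k[OF P w] by (simp add: diff_k_eq)
  then show ?thesis
    using diff_k_const_red[OF P _ bdry_elems[OF P tensor_k_lift(2)[OF w]]] bdry_bdry[OF P tensor_k_lift(2)[OF w]]
    by (simp add: diff_k_eq[of P w])
qed

lemma diff_k_add:
  assumes "free_resolution P I" "v \<in> tensor_k P i j" "w \<in> tensor_k P i j"
  shows "diff_k P (v + w) = diff_k P v + diff_k P w"
  using assms by (simp add: diff_k_eq const_lift_add const_red_add bdry_add[OF assms(1)] tensor_k_lift)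

lemma diff_k_pscale:
  assumes "free_resolution P I" "v \<in> tensor_k P i j"
  shows "diff_k P (pscale c v) = pscale c (diff_k P v)"
  using assms by (simp add: diff_k_eq const_lift_pscale const_red_pscale bdry_pscale[OF assms(1)] tensor_k_lift)

text \<open>The set \<open>T\<close> replaces finite dimension of the ambient space. A basis of \<open>B\<close> together with \<open>w\<close> extends
  to a basis of \<open>Z\<close>.\<close>

lemma (in vector_space) dim_less:
  assumes "finite T" "Z \<subseteq> span T" "B \<subseteq> Z" "subspace B" "w \<in> Z" "w \<notin> B"
  shows "dim B < dim Z"
proof -
  obtain C where C: "C \<subseteq> B" "independent C" "B \<subseteq> span C" "card C = dim B"
    by (rule basis_exists)
  have "span C \<subseteq> B"
    using C(1) assms(4) by (rule span_minimal)
  then have w: "w \<notin> span C" using assms(6) by blast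
  have "insert w C \<subseteq> Z" using C(1) assms(3,5) by blast
  moreover have "independent (insert w C)" using w C(2) by (rule independent_insertI)
  ultimately obtain D where D: "insert w C \<subseteq> D" "D \<subseteq> Z" "independent D" "Z \<subseteq> span D"
    by (rule maximal_independent_subset_extend)
  have fin: "finite D"
    using independent_span_bound[OF assms(1) D(3)] D(2) assms(2) by blast
  then have "finite C" using D(1) by (auto intro: finite_subset)
  moreover have "w \<notin> C" using w span_base by blast
  ultimately have "dim B < card (insert w C)" using C(4) by simp
  also have "\<dots> \<le> card D" using fin D(1) by (rule card_mono)
  also have "\<dots> = dim Z" using D(2,4,3) by (rule basis_card_eq_dim)
  finally show ?thesis .
qed

lemma homology_dim_eq_0:
  assumes P: "free_resolution P I"
    and "\<And>w. w \<in> tensor_k P i j \<Longrightarrow> diff_k P w = 0 \<Longrightarrow> w \<in> diff_k P ` tensor_k P (Suc i) j"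
  shows "homology_dim P i j = 0"
proof -
  have "{w \<in> tensor_k P i j. diff_k P w = 0} = diff_k P ` tensor_k P (Suc i) j"
    using assms(2) diff_k_tensor_k[OF P] diff_k_diff_k[OF P] by blast
  then show ?thesis by (simp add: homology_dim_def)
qed

lemma homology_dim_neq_0:
  fixes P :: "('n::finite, 'k::field) gcomplex"
  assumes P: "free_resolution P I"
    and w: "w \<in> tensor_k P i j" "diff_k P w = 0" "w \<notin> diff_k P ` tensor_k P (Suc i) j"
  shows "homology_dim P i j \<noteq> 0"
proof -
  interpret vs: vector_space "pscale :: 'k \<Rightarrow> (nat \<Rightarrow>\<^sub>0 'k) \<Rightarrow> _"
    by (rule vector_space_pscale)
  define G where "G = {b \<in> gens P. hdeg P b = i \<and> (\<Sum>x\<in>UNIV. mdeg P b x) = j}"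
  have "finite {b \<in> gens P. hdeg P b = i}"
    by (rule graded_free_complexD(1)[OF resolution_graded[OF P]])
  then have "finite G" by (rule rev_finite_subset) (auto simp: G_def)
  then have "finite ((\<lambda>b. single b (1::'k)) ` G)" by (rule finite_imageI)
  moreover have "{w \<in> tensor_k P i j. diff_k P w = 0} \<subseteq> vs.span ((\<lambda>b. single b 1) ` G)"
  proof
    fix v assume "v \<in> {w \<in> tensor_k P i j. diff_k P w = 0}"
    then have "keys v \<subseteq> G" by (simp add: tensor_k_def G_def)
    then have "(\<Sum>b\<in>keys v. pscale (lookup v b) (single b 1)) \<in> vs.span ((\<lambda>b. single b 1) ` G)"
      by (intro vs.span_sum vs.span_scale vs.span_base) blast
    then show "v \<in> vs.span ((\<lambda>b. single b 1) ` G)" by (simp add: sum_pscale_unit)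
  qed
  moreover have "diff_k P ` tensor_k P (Suc i) j \<subseteq> {w \<in> tensor_k P i j. diff_k P w = 0}"
    using diff_k_tensor_k[OF P] diff_k_diff_k[OF P] by blast
  moreover have "vs.subspace (diff_k P ` tensor_k P (Suc i) j)"
    unfolding vs.subspace_def
  proof (intro conjI ballI allI)
    have "diff_k P 0 = 0" by (simp add: diff_k_eq bdry_0[OF P])
    then show "0 \<in> diff_k P ` tensor_k P (Suc i) j"
      using tensor_k_0 by (metis image_eqI)
  next
    fix x y assume "x \<in> diff_k P ` tensor_k P (Suc i) j" "y \<in> diff_k P ` tensor_k P (Suc i) j"
    then obtain v w where vw: "v \<in> tensor_k P (Suc i) j" "w \<in> tensor_k P (Suc i) j"
      "x = diff_k P v" "y = diff_k P w" by blast
    then have "x + y = diff_k P (v + w)" by (simp add: diff_k_add[OF P vw(1,2)])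
    with tensor_k_add[OF vw(1,2)] show "x + y \<in> diff_k P ` tensor_k P (Suc i) j" by blast
  next
    fix c x assume "x \<in> diff_k P ` tensor_k P (Suc i) j"
    then obtain v where v: "v \<in> tensor_k P (Suc i) j" "x = diff_k P v" by blast
    then have "pscale c x = diff_k P (pscale c v)" by (simp add: diff_k_pscale[OF P v(1)])
    with tensor_k_pscale[OF v(1)] show "pscale c x \<in> diff_k P ` tensor_k P (Suc i) j" by blast
  qed
  ultimately have "vs.dim (diff_k P ` tensor_k P (Suc i) j) < vs.dim {w \<in> tensor_k P i j. diff_k P w = 0}"
    using w by (intro vs.dim_less) auto
  then show ?thesis by (simp add: homology_dim_def)
qed

text \<open>Let \<open>f\<close> and \<open>g\<close> be mutually inverse homotopy equivalences, read in the tensor product with \<open>k\<close>.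
  If \<open>F\<close> has no basis element in the degree \<open>(i, j)\<close>, then \<open>f : P \<rightarrow> F\<close> maps each cycle there to zero,
  so the homotopy on \<open>P\<close> exhibits it as a boundary. Conversely, take \<open>f : F \<rightarrow> P\<close>. The differential of
  \<open>F \<otimes> k\<close> is zero, so \<open>g (f b) = b\<close> for a basis element \<open>b\<close> of \<open>F\<close>; therefore the cycle \<open>f b\<close> is
  not a boundary, as \<open>g\<close> sends boundaries to zero.\<close>

lemma homology_dim_neq_0_iff:
  fixes F P :: "('n::finite, 'k::field) gcomplex"
  assumes sqf: "squarefree_monomial_ideal I" and minimal: "minimal_free_resolution F u I"
    and P: "free_resolution P I"
  shows "homology_dim P i j \<noteq> 0 \<longleftrightarrow> (\<exists>g\<in>gens F. hdeg F g = i \<and> (\<Sum>x\<in>UNIV. mdeg F g x) = j)"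
proof
  note F = minimal_resolution[OF minimal]
  assume nz: "homology_dim P i j \<noteq> 0"
  show "\<exists>g\<in>gens F. hdeg F g = i \<and> (\<Sum>x\<in>UNIV. mdeg F g x) = j"
  proof (rule ccontr)
    assume no_gen: "\<not> ?thesis"
    obtain f g h where f: "graded_chain_map P F I f" and h: "graded_on_gens P P 1 h"
      and homotopy: "\<And>v. v \<in> elems P \<Longrightarrow>
        lin_ext g (lin_ext f v) = v + bdry P (lin_ext h v) + lin_ext h (bdry P v)"
      using graded_homotopy_equivalence[OF sqf P F] by metis
    have "w \<in> diff_k P ` tensor_k P (Suc i) j" if w: "w \<in> tensor_k P i j" "diff_k P w = 0" for w
    proof -
      note v = tensor_k_lift[OF w(1)]
      define y where "y = lin_ext h (const_lift w)"
      have "const_red (lin_ext f (const_lift w)) \<in> tensor_k F i j"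
        using f by (intro const_red_lin_ext_tensor_k[OF w(1)])
          (auto simp: graded_chain_map_def graded_on_gens_def)
      moreover have "tensor_k F i j = {0}"
      proof -
        have "{b \<in> gens F. hdeg F b = i \<and> (\<Sum>x\<in>UNIV. mdeg F b x) = j} = {}"
          using no_gen by blast
        then show ?thesis unfolding tensor_k_def by (simp only: subset_empty keys_eq_empty) simp
      qed
      ultimately have "const_red (lin_ext f (const_lift w)) = 0" by blast
      then have "const_red (lin_ext g (lin_ext f (const_lift w))) = 0"
        by (rule const_red_lin_ext_eq_0)
      moreover have "const_red (lin_ext h (bdry P (const_lift w))) = 0"
        using w(2) by (intro const_red_lin_ext_eq_0) (simp add: diff_k_eq)
      ultimately have "w + const_red (bdry P y) = 0"
        using arg_cong[OF homotopy[OF v(2)], of const_red] by (simp add: const_red_add y_def)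
      moreover have y: "const_red y \<in> tensor_k P (Suc i) j"
        unfolding y_def using h
        by (intro const_red_lin_ext_tensor_k[OF w(1)]) (auto simp: graded_on_gens_def)
      moreover have "y \<in> elems P"
        unfolding y_def by (rule graded_on_gens_lin_ext(3)[OF h v(2)])
      ultimately have "w = - diff_k P (const_red y)"
        by (simp add: diff_k_const_red[OF P] eq_neg_iff_add_eq_0)
      also have "\<dots> = pscale (- 1) (diff_k P (const_red y))"
        by (simp add: module.scale_minus_left[OF module_pscale])
      also have "\<dots> = diff_k P (pscale (- 1) (const_red y))"
        by (simp add: diff_k_pscale[OF P y])
      finally show ?thesis using tensor_k_pscale[OF y] by blast
    qed
    then have "homology_dim P i j = 0" by (rule homology_dim_eq_0[OF P])
    with nz show False by simp
  qed
next
  note F = minimal_resolution[OF minimal]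
  assume "\<exists>g\<in>gens F. hdeg F g = i \<and> (\<Sum>x\<in>UNIV. mdeg F g x) = j"
  then obtain b where b: "b \<in> gens F" "hdeg F b = i" "(\<Sum>x\<in>UNIV. mdeg F b x) = j" by blast
  obtain f g h where f: "graded_chain_map F P I f" and g: "graded_chain_map P F I g"
    and h: "graded_on_gens F F 1 h"
    and homotopy: "\<And>v. v \<in> elems F \<Longrightarrow>
      lin_ext g (lin_ext f v) = v + bdry F (lin_ext h v) + lin_ext h (bdry F v)"
    using graded_homotopy_equivalence[OF sqf F P] by metis
  have bdry_red: "const_red (bdry F v) = 0" if "v \<in> elems F" for v
    using minimal_bdry_const_coeff[OF minimal that]
    by (intro poly_mapping_eqI) (simp add: lookup_const_red)
  define v :: "nat \<Rightarrow>\<^sub>0 ('n, 'k) mpoly" where "v = single b 1"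
  have v: "v \<in> elems F" unfolding v_def using b(1) by (rule single_in_elems)
  have v_lift: "v = const_lift (single b 1)"
    by (rule poly_mapping_eqI) (simp add: v_def lookup_const_lift lookup_single when_def)
  have fv: "lin_ext f v \<in> elems P"
    using f graded_on_gens_lin_ext(3) v unfolding graded_chain_map_def by blast
  define w where "w = const_red (lin_ext f v)"
  have "single b 1 \<in> tensor_k F i j" using b by (simp add: tensor_k_def)
  then have w: "w \<in> tensor_k P i j"
    unfolding w_def v_lift using f
    by (intro const_red_lin_ext_tensor_k) (auto simp: graded_chain_map_def graded_on_gens_def)
  have "diff_k P w = const_red (bdry P (lin_ext f v))"
    using w fv unfolding w_def by (rule diff_k_const_red[OF P])
  also have "\<dots> = const_red (lin_ext f (bdry F v))"
    using f v by (simp add: graded_chain_map_def)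
  also have "\<dots> = 0"
    by (intro const_red_lin_ext_eq_0 bdry_red v)
  finally have cycle: "diff_k P w = 0" .
  have "w \<notin> diff_k P ` tensor_k P (Suc i) j"
  proof
    assume "w \<in> diff_k P ` tensor_k P (Suc i) j"
    then obtain w' where w': "w' \<in> tensor_k P (Suc i) j" "w = diff_k P w'" by blast
    note lift = tensor_k_lift(2)[OF w'(1)]
    have "const_red (lin_ext g (lin_ext f v)) = const_red (lin_ext g (bdry P (const_lift w')))"
      using w'(2) by (intro const_red_lin_ext_cong) (simp add: w_def diff_k_eq)
    also have "\<dots> = const_red (bdry F (lin_ext g (const_lift w')))"
      using g lift by (simp add: graded_chain_map_def)
    also have "\<dots> = 0"
      using g graded_on_gens_lin_ext(3) lift unfolding graded_chain_map_def by (intro bdry_red) blast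
    finally have "const_red (lin_ext g (lin_ext f v)) = 0" .
    moreover have "const_red (bdry F (lin_ext h v)) = 0"
      using graded_on_gens_lin_ext(3)[OF h v] by (rule bdry_red)
    moreover have "const_red (lin_ext h (bdry F v)) = 0"
      by (intro const_red_lin_ext_eq_0 bdry_red v)
    ultimately have "const_red v = 0"
      using arg_cong[OF homotopy[OF v], of const_red] by (simp add: const_red_add)
    then have "single b (1::'k) = 0" by (simp add: v_lift)
    then show False by (metis lookup_single_eq lookup_zero zero_neq_one)
  qed
  with w cycle show "homology_dim P i j \<noteq> 0" by (rule homology_dim_neq_0[OF P])
qed

lemma betti_neq_0_iff:
  fixes F :: "('n::finite, 'k::field) gcomplex"
  assumes "squarefree_monomial_ideal I" and minimal: "minimal_free_resolution F u I"
  shows "betti I i j \<noteq> 0 \<longleftrightarrow> (\<exists>g\<in>gens F. hdeg F g = i \<and> (\<Sum>x\<in>UNIV. mdeg F g x) = j)"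
proof -
  have "free_resolution (SOME P. free_resolution P I) I"
    using minimal_resolution[OF minimal] by (rule someI)
  then show ?thesis
    unfolding betti_def by (rule homology_dim_neq_0_iff[OF assms])
qed

lemma tdeg_eq_Max:
  assumes "squarefree_monomial_ideal I" "minimal_free_resolution F u I"
  shows "tdeg I i = Max ((\<lambda>g. \<Sum>x\<in>UNIV. mdeg F g x) ` {g \<in> gens F. hdeg F g = i})"
proof -
  have "{j. betti I i j \<noteq> 0} = (\<lambda>g. \<Sum>x\<in>UNIV. mdeg F g x) ` {g \<in> gens F. hdeg F g = i}"
    unfolding betti_neq_0_iff[OF assms] by blast
  then show ?thesis by (simp add: tdeg_def)
qed

text \<open>If \<open>F\<^sub>b\<close> were zero, then the basis elements of \<open>F\<^sub>b\<^sub>+\<^sub>1\<close> would be cycles, which minimality forbids, so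
  \<open>F\<^sub>b\<^sub>+\<^sub>1\<close> would be zero, and so on. Then \<open>F\<close> itself would be a resolution of length less than \<open>b\<close>.\<close>

lemma minimal_gens_nonempty:
  assumes minimal: "minimal_free_resolution F u I" and b: "enat b \<le> pdim I"
  shows "{g \<in> gens F. hdeg F g = b} \<noteq> {}"
proof
  assume empty: "{g \<in> gens F. hdeg F g = b} = {}"
  have res: "free_resolution F I" by (rule minimal_resolution[OF minimal])
  have "b \<noteq> 0" using empty minimal_u[OF minimal] by auto
  then obtain l where l: "b = Suc l" by (cases b) auto
  have none: "hdeg F g \<noteq> b + n" if "g \<in> gens F" for n g
    using that
  proof (induction n arbitrary: g)
    case 0
    then show ?case using empty by auto
  next
    case (Suc n)
    show ?case
    proof
      assume g: "hdeg F g = b + Suc n"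
      have "bdry F (single g 1) \<in> component F (b + n)"
        using bdry_gen_component[OF res Suc.prems] g by simp
      then have "keys (bdry F (single g 1)) = {}"
        using Suc.IH unfolding component_eq by blast
      then have "bdry F (single g 1) = 0" by (simp only: keys_eq_empty)
      then show False using minimal_bdry_gen_nonzero[OF minimal Suc.prems] g by simp
    qed
  qed
  have "hdeg F g \<le> l" if "g \<in> gens F" for g
    using none[OF that, of "hdeg F g - b"] l by (cases "b \<le> hdeg F g") auto
  then have "pdim I \<le> enat l"
    unfolding pdim_def using res by (intro Inf_lower) blast
  with b have "enat (Suc l) \<le> enat l" unfolding l by (rule order_trans)
  then show False by simp
qed

section \<open>Subadditivity\<close>

theorem proposition4p4:
  fixes I :: "('n::finite, 'k::field) mpoly set"
    and F :: "('n, 'k) gcomplex" and u :: nat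
  assumes "squarefree_monomial_ideal I" and "I \<noteq> UNIV"
    and "minimal_free_resolution F u I"
    and "admits_dga_structure F u"
  shows "\<forall>a b. 1 \<le> a \<and> a < b \<and> enat b \<le> pdim I \<longrightarrow> tdeg I b \<le> tdeg I a + tdeg I (b - a)"
proof (intro allI impI)
  fix a b assume ab: "1 \<le> a \<and> a < b \<and> enat b \<le> pdim I"
  let ?deg = "\<lambda>g. \<Sum>x\<in>UNIV. mdeg F g x"
  let ?G = "\<lambda>i. {g \<in> gens F. hdeg F g = i}"
  note tdeg = tdeg_eq_Max[OF assms(1,3)]
  obtain mul where dga: "dga_structure F u mul"
    using assms(4) by (auto simp: admits_dga_structure_def)
  have fin: "finite (?G i)" for i
    by (rule graded_free_complexD(1)[OF resolution_graded[OF minimal_resolution[OF assms(3)]]])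
  have "tdeg I b \<in> ?deg ` ?G b"
    unfolding tdeg using fin minimal_gens_nonempty[OF assms(3)] ab by (intro Max_in) auto
  then obtain g where g: "g \<in> gens F" "hdeg F g = b" "tdeg I b = ?deg g" by blast
  obtain p q where pq: "p \<in> gens F" "hdeg F p = a" "q \<in> gens F" "hdeg F q = b - a"
    "?deg g \<le> ?deg p + ?deg q"
    using gen_degree_le_product[OF assms(3,1) dga, of a g] g ab by (metis less_imp_le)
  have "?deg p \<le> tdeg I a" "?deg q \<le> tdeg I (b - a)"
    unfolding tdeg using pq fin by (auto intro!: Max_ge)
  with g(3) pq(5) show "tdeg I b \<le> tdeg I a + tdeg I (b - a)" by linarith
qed

end
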